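(* Let $(\mathbb G,\mathcal E)$ be a linear algebraic group over $k$ equipped with a structure of exponential type $\mathcal E: \mathcal N_p(\mathfrak g)\times \mathbb G_a \to \mathbb G$. For $d \ge 0$ let $$\mathcal E(\mathbb G)_d \equiv (\mathcal E^{*})^{-1}\big(k[\mathcal N_p(\mathfrak g)][t]_{\leq d}\big) \subset \mathcal O(\mathbb G),$$ where $k[\mathcal N_p(\mathfrak g)][t]_{\leq d} \subset k[\mathcal N_p(\mathfrak g)][t] = k[\mathcal N_p(\mathfrak g)\times\mathbb G_a]$ is the subspace of polynomials in $t$ of degree $\leq d$ with coefficients in $k[\mathcal N_p(\mathfrak g)]$. Let $M$ be a $\mathbb G$-module. Then $\{M_{\mathcal E(\mathbb G)_d}\}$ is the coarsest filtration of $M$ by $\mathbb G$-submodules subordinate to the filtration by exponential degree $\{M_{[d]}\}$. That is, $\{M_{\mathcal E(\mathbb G)_d}\}$ is an ascending filtration of $M$ by $\mathbb G$-submodules with union $M$ and with $M_{\mathcal E(\mathbb G)_d} \subset M_{[d]}$ for all $d$, and any filtration $\{N_d\}$ of $M$ by $\mathbb G$-submodules with $N_d \subset M_{[d]}$ for all $d$ satisfies $N_d \subset M_{\mathcal E(\mathbb G)_d}$ for all $d$.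
   Context: $k$ is a field of characteristic $p>0$. A linear algebraic group is a smooth connected affine group scheme of finite type over $k$; $\mathcal O(\mathbb G)$ is its coordinate algebra and $\mathfrak g = Lie(\mathbb G)$. A $\mathbb G$-module is a (possibly infinite dimensional) right $\mathcal O(\mathbb G)$-comodule $M$ with coaction $\Delta_M: M\to M\otimes\mathcal O(\mathbb G)$. For a $k$-subspace $X\subset\mathcal O(\mathbb G)$, an $X$-comodule is a $\mathbb G$-module whose coaction factors through $M\otimes X$, and $M_X\subset M$ is the union of all $\mathbb G$-submodules of $M$ which are $X$-comodules. The filtration by exponential degree of $M$ consists of the subspaces $M_{[d]} = \{m\in M : \Delta_M(m)\in M\otimes \mathcal E(\mathbb G)_d\}$ (not required to be $\mathbb G$-submodules). $\mathcal N_p(\mathfrak g)\subset\mathfrak g$ is the $p$-nilpotent cone, consisting of those $B\in\mathfrak g$ with $B^{[p]}=0$; $\mathcal C_r(\mathcal N_p(\mathfrak g))$ is the variety of $r$-tuples of pairwise commuting elements of $\mathcal N_p(\mathfrak g)$. $\mathbb G_{(r)}$ denotes the $r$-th Frobenius kernel of $\mathbb G$, $\mathbb G_{a(r)}$ that of $\mathbb G_a$, $i_r:\mathbb G_{a(r)}\to\mathbb G_a$ the inclusion, $F$ the Frobenius of $\mathbb G_a$, and $V(\mathbb G_{(r)})$ the scheme representing the functor of (infinitesimal) 1-parameter subgroups $\mathbb G_{a(r)}\to\mathbb G_{(r)}$. A structure of exponential type on $\mathbb G$ is a $\mathbb G$-equivariant morphism of $k$-schemes (for the adjoint actions) $\mathcal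 E:\mathcal N_p(\mathfrak g)\times\mathbb G_a\to\mathbb G$, $(B,s)\mapsto\mathcal E_B(s)$, such that for all field extensions $K/k$: (i) for each $B\in\mathcal N_p(\mathfrak g)(K)$, $\mathcal E_B:\mathbb G_{a,K}\to\mathbb G_K$ is a 1-parameter subgroup; (ii) for any commuting $p$-nilpotent $B,B'\in\mathfrak g_K$, the maps $\mathcal E_B,\mathcal E_{B'}:\mathbb G_{a,K}\to\mathbb G_K$ commute; (iii) for $\alpha\in K$ and $s\in\mathbb G_a(K)$, $\mathcal E_{\alpha\cdot B}(s)=\mathcal E_B(\alpha\cdot s)$; (iv) every 1-parameter subgroup $\psi:\mathbb G_{a,K}\to\mathbb G_K$ is of the form $\mathcal E_{\underline B}\equiv\prod_{s=0}^{r-1}(\mathcal E_{B_s}\circ F^s)$ for some $r>0$ and some $\underline B = (B_0,\dots,B_{r-1})\in\mathcal C_r(\mathcal N_p(\mathfrak g_K))$; (v) the natural map $\mathcal C_r(\mathcal N_p(\mathfrak g))\to V(\mathbb G_{(r)})$ induces a bijection on $K$-points, sending $\underline B$ to the infinitesimal 1-parameter subgroup $\mathbb G_{a(r),K}\to\mathbb G_{(r),K}$ through which $\mathcal E_{\underline B}\circ i_r:\mathbb G_{a(r),K}\to\mathbb G_{a,K}\to\mathbb G_K$ factors. $\mathcal E^*:\mathcal O(\mathbb G)\to k[\mathcal N_p(\mathfrak g)\times\mathbb G_a]$ is the map on coordinate algebras induced by $\mathcal E$. *)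

theory Defs
  imports
    "HOL-Algebra.Module"
    "HOL-Algebra.UnivPoly"
    "HOL-Algebra.QuotRing"
    "HOL-Algebra.Generated_Rings"
begin

text \<open>
  Affine group schemes are given by their coordinate Hopf algebras.  Field extensions of \<open>k\<close> and
  the \<open>k\<close>-algebras at which functors of points are evaluated have their carriers in a type
  \<open>'u\<close>, which is passed to the definitions that quantify over such objects as an argument
  \<open>TYPE('u)\<close>; it is a free type variable of the final statement.
\<close>

section \<open>Linear algebra over a commutative ring\<close>

definition has_characteristic :: "('r, 'x) ring_scheme \<Rightarrow> nat \<Rightarrow> bool"
  where "has_characteristic R p \<longleftrightarrow> (\<forall>n::nat. [n] \<cdot>\<^bsub>R\<^esub> \<one>\<^bsub>R\<^esub> = \<zero>\<^bsub>R\<^esub> \<longleftrightarrow> p dvd n)"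

definition linear_maps ::
  "('r, 'x) ring_scheme \<Rightarrow> ('r, 'm, 'y) module_scheme \<Rightarrow> ('r, 'n, 'z) module_scheme \<Rightarrow> ('m \<Rightarrow> 'n) set"
  where "linear_maps R M N = {f \<in> carrier M \<rightarrow> carrier N.
    (\<forall>x\<in>carrier M. \<forall>y\<in>carrier M. f (x \<oplus>\<^bsub>M\<^esub> y) = f x \<oplus>\<^bsub>N\<^esub> f y) \<and>
    (\<forall>c\<in>carrier R. \<forall>x\<in>carrier M. f (c \<odot>\<^bsub>M\<^esub> x) = c \<odot>\<^bsub>N\<^esub> f x)}"

definition algebra_homs ::
  "('r, 'x) ring_scheme \<Rightarrow> ('r, 'm, 'y) module_scheme \<Rightarrow> ('r, 'n, 'z) module_scheme \<Rightarrow> ('m \<Rightarrow> 'n) set"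
  where "algebra_homs R A B = linear_maps R A B \<inter> ring_hom A B"

definition self_algebra :: "('r, 'x) ring_scheme \<Rightarrow> ('r, 'r) module"
  where "self_algebra R = \<lparr>carrier = carrier R, monoid.mult = monoid.mult R, one = one R, zero = zero R,
    add = add R, smult = monoid.mult R\<rparr>"

definition subalgebra_generated ::
  "('r, 'x) ring_scheme \<Rightarrow> ('r, 'm, 'y) module_scheme \<Rightarrow> 'm set \<Rightarrow> 'm set"
  where "subalgebra_generated R A S =
    generate_ring A ((\<lambda>c. c \<odot>\<^bsub>A\<^esub> \<one>\<^bsub>A\<^esub>) ` carrier R \<union> S)"

definition quotient_algebra :: "('r, 'm, 'y) module_scheme \<Rightarrow> 'm set \<Rightarrow> ('r, 'm set) module"
  where "quotient_algebra A J = \<lparr>carrier = carrier (A Quot J), monoid.mult = monoid.mult (A Quot J),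
    one = one (A Quot J), zero = zero (A Quot J), add = add (A Quot J),
    smult = (\<lambda>c X. \<Union>x\<in>X. J +>\<^bsub>A\<^esub> (c \<odot>\<^bsub>A\<^esub> x))\<rparr>"

definition quotient_map ::
  "('r, 'm, 'y) module_scheme \<Rightarrow> 'm set \<Rightarrow> ('m \<Rightarrow> 'n) \<Rightarrow> 'm set \<Rightarrow> 'n"
  where "quotient_map A J f = (\<lambda>X\<in>carrier (A Quot J). the_elem (f ` X))"

text \<open>\<open>B[t]\<close> as an algebra over the base ring of \<open>B\<close>, where \<open>UP B\<close> is an algebra over \<open>B\<close>.\<close>

definition poly_algebra :: "('r, 'm, 'y) module_scheme \<Rightarrow> ('r, nat \<Rightarrow> 'm) module"
  where "poly_algebra B = \<lparr>carrier = carrier (UP B), monoid.mult = monoid.mult (UP B), one = one (UP B),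
    zero = zero (UP B), add = add (UP B), smult = (\<lambda>c f n. c \<odot>\<^bsub>B\<^esub> f n)\<rparr>"

section \<open>Tensor products\<close>

text \<open>
  The list \<open>[(m\<^sub>1, n\<^sub>1), \<dots>]\<close> stands for the formal sum \<open>m\<^sub>1 \<otimes> n\<^sub>1 + \<dots>\<close>.  The tensor
  product is the free commutative monoid on \<open>M \<times> N\<close> modulo the congruence generated by the
  bilinearity relations (in a monoid \<open>0 \<otimes> 0 = 0\<close> has to be among them).
\<close>

inductive tensor_eq ::
  "('r, 'x) ring_scheme \<Rightarrow> ('r, 'm, 'y) module_scheme \<Rightarrow> ('r, 'n, 'z) module_scheme \<Rightarrow>
   ('m \<times> 'n) list \<Rightarrow> ('m \<times> 'n) list \<Rightarrow> bool"
  for R M N where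
  refl: "set xs \<subseteq> carrier M \<times> carrier N \<Longrightarrow> tensor_eq R M N xs xs"
| sym: "tensor_eq R M N xs ys \<Longrightarrow> tensor_eq R M N ys xs"
| trans: "tensor_eq R M N xs ys \<Longrightarrow> tensor_eq R M N ys zs \<Longrightarrow> tensor_eq R M N xs zs"
| append: "tensor_eq R M N xs xs' \<Longrightarrow> tensor_eq R M N ys ys' \<Longrightarrow>
    tensor_eq R M N (xs @ ys) (xs' @ ys')"
| comm: "set (xs @ ys) \<subseteq> carrier M \<times> carrier N \<Longrightarrow> tensor_eq R M N (xs @ ys) (ys @ xs)"
| zero: "tensor_eq R M N [(\<zero>\<^bsub>M\<^esub>, \<zero>\<^bsub>N\<^esub>)] []"
| add_left: "m \<in> carrier M \<Longrightarrow> m' \<in> carrier M \<Longrightarrow> n \<in> carrier N \<Longrightarrow>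
    tensor_eq R M N [(m \<oplus>\<^bsub>M\<^esub> m', n)] [(m, n), (m', n)]"
| add_right: "m \<in> carrier M \<Longrightarrow> n \<in> carrier N \<Longrightarrow> n' \<in> carrier N \<Longrightarrow>
    tensor_eq R M N [(m, n \<oplus>\<^bsub>N\<^esub> n')] [(m, n), (m, n')]"
| smult: "c \<in> carrier R \<Longrightarrow> m \<in> carrier M \<Longrightarrow> n \<in> carrier N \<Longrightarrow>
    tensor_eq R M N [(c \<odot>\<^bsub>M\<^esub> m, n)] [(m, c \<odot>\<^bsub>N\<^esub> n)]"

definition tensor_class ::
  "('r, 'x) ring_scheme \<Rightarrow> ('r, 'm, 'y) module_scheme \<Rightarrow> ('r, 'n, 'z) module_scheme \<Rightarrow>
   ('m \<times> 'n) list \<Rightarrow> ('m \<times> 'n) list set"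
  where "tensor_class R M N xs = {ys. tensor_eq R M N xs ys}"

text \<open>
  The ring structure (\<open>mult\<close> and \<open>one\<close>) is meaningful only if \<open>M\<close> and \<open>N\<close> are algebras.
\<close>

definition tensor ::
  "('r, 'x) ring_scheme \<Rightarrow> ('r, 'm, 'y) module_scheme \<Rightarrow> ('r, 'n, 'z) module_scheme \<Rightarrow>
   ('r, ('m \<times> 'n) list set) module"
  where "tensor R M N = \<lparr>
    carrier = tensor_class R M N ` {xs. set xs \<subseteq> carrier M \<times> carrier N},
    monoid.mult = (\<lambda>X Y. \<Union>xs\<in>X. \<Union>ys\<in>Y. tensor_class R M N
      [(m \<otimes>\<^bsub>M\<^esub> m', n \<otimes>\<^bsub>N\<^esub> n'). (m, n) \<leftarrow> xs, (m', n') \<leftarrow> ys]),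
    one = tensor_class R M N [(\<one>\<^bsub>M\<^esub>, \<one>\<^bsub>N\<^esub>)],
    zero = tensor_class R M N [],
    add = (\<lambda>X Y. \<Union>xs\<in>X. \<Union>ys\<in>Y. tensor_class R M N (xs @ ys)),
    smult = (\<lambda>c X. \<Union>xs\<in>X. tensor_class R M N [(c \<odot>\<^bsub>M\<^esub> m, n). (m, n) \<leftarrow> xs])\<rparr>"

definition pure_tensor ::
  "('r, 'x) ring_scheme \<Rightarrow> ('r, 'm, 'y) module_scheme \<Rightarrow> ('r, 'n, 'z) module_scheme \<Rightarrow>
   'm \<Rightarrow> 'n \<Rightarrow> ('m \<times> 'n) list set"
  where "pure_tensor R M N m n = tensor_class R M N [(m, n)]"

text \<open>The additive map on \<open>M \<otimes> N\<close> induced by a balanced biadditive map \<open>\<beta>\<close> into \<open>W\<close>.\<close>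

definition tensor_lift ::
  "('w, 'x) ring_scheme \<Rightarrow> ('m \<Rightarrow> 'n \<Rightarrow> 'w) \<Rightarrow> ('m \<times> 'n) list set \<Rightarrow> 'w"
  where "tensor_lift W \<beta> X =
    the_elem ((\<lambda>xs. foldr (\<lambda>(m, n) w. \<beta> m n \<oplus>\<^bsub>W\<^esub> w) xs \<zero>\<^bsub>W\<^esub>) ` X)"

definition tensor_map ::
  "('r, 'x) ring_scheme \<Rightarrow> ('r, 'm, 'y) module_scheme \<Rightarrow> ('r, 'n, 'z) module_scheme \<Rightarrow>
   ('a \<Rightarrow> 'm) \<Rightarrow> ('b \<Rightarrow> 'n) \<Rightarrow> ('a \<times> 'b) list set \<Rightarrow> ('m \<times> 'n) list set"
  where "tensor_map R M N f g =
    tensor_lift (tensor R M N) (\<lambda>a b. pure_tensor R M N (f a) (g b))"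

definition tensor_swap ::
  "('r, 'x) ring_scheme \<Rightarrow> ('r, 'm, 'y) module_scheme \<Rightarrow> ('r, 'n, 'z) module_scheme \<Rightarrow>
   ('m \<times> 'n) list set \<Rightarrow> ('n \<times> 'm) list set"
  where "tensor_swap R M N = tensor_lift (tensor R N M) (\<lambda>m n. pure_tensor R N M n m)"

definition tensor_assoc ::
  "('r, 'x) ring_scheme \<Rightarrow> ('r, 'l, 'v) module_scheme \<Rightarrow> ('r, 'm, 'y) module_scheme \<Rightarrow>
   ('r, 'n, 'z) module_scheme \<Rightarrow>
   (('l \<times> 'm) list set \<times> 'n) list set \<Rightarrow> ('l \<times> ('m \<times> 'n) list set) list set"
  where "tensor_assoc R L M N =
    (let T = tensor R L (tensor R M N) in
     tensor_lift T (\<lambda>X n. tensor_lift T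
       (\<lambda>l m. pure_tensor R L (tensor R M N) l (pure_tensor R M N m n)) X))"

text \<open>
  The image of \<open>N \<otimes> X\<close> in \<open>M \<otimes> A\<close>, for subsets \<open>N\<close> of \<open>M\<close> and \<open>X\<close> of \<open>A\<close>; if they are
  subspaces over a field, it is identified with \<open>N \<otimes> X\<close>.
\<close>

definition tensor_image ::
  "('r, 'x) ring_scheme \<Rightarrow> ('r, 'm, 'y) module_scheme \<Rightarrow> ('r, 'a, 'z) module_scheme \<Rightarrow>
   'm set \<Rightarrow> 'a set \<Rightarrow> ('m \<times> 'a) list set set"
  where "tensor_image R M A N X = tensor_class R M A ` {xs. set xs \<subseteq> N \<times> X}"

section \<open>Affine group schemes\<close>

record ('k, 'a) hopf_algebra = "('k, 'a) module" +
  comult :: "'a \<Rightarrow> ('a \<times> 'a) list set"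
  counit :: "'a \<Rightarrow> 'k"
  antipode :: "'a \<Rightarrow> 'a"

text \<open>\<open>G\<close> is the coordinate algebra of the group scheme.\<close>

locale affine_group_scheme = field k + algebra k G
  for k :: "('k, 'x) ring_scheme" and G :: "('k, 'a) hopf_algebra" +
  assumes comult_hom: "comult G \<in> algebra_homs k G (tensor k G G)"
    and counit_hom: "counit G \<in> algebra_homs k G (self_algebra k)"
    and antipode_hom: "antipode G \<in> algebra_homs k G G"
    and coassociative: "\<And>a. a \<in> carrier G \<Longrightarrow>
      tensor_assoc k G G G (tensor_map k (tensor k G G) G (comult G) (\<lambda>b. b) (comult G a)) =
      tensor_map k G (tensor k G G) (\<lambda>b. b) (comult G) (comult G a)"
    and counit_left: "\<And>a. a \<in> carrier G \<Longrightarrow>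
      tensor_lift G (\<lambda>x y. counit G x \<odot>\<^bsub>G\<^esub> y) (comult G a) = a"
    and counit_right: "\<And>a. a \<in> carrier G \<Longrightarrow>
      tensor_lift G (\<lambda>x y. counit G y \<odot>\<^bsub>G\<^esub> x) (comult G a) = a"
    and antipode_left: "\<And>a. a \<in> carrier G \<Longrightarrow>
      tensor_lift G (\<lambda>x y. antipode G x \<otimes>\<^bsub>G\<^esub> y) (comult G a) = counit G a \<odot>\<^bsub>G\<^esub> \<one>\<^bsub>G\<^esub>"
    and antipode_right: "\<And>a. a \<in> carrier G \<Longrightarrow>
      tensor_lift G (\<lambda>x y. x \<otimes>\<^bsub>G\<^esub> antipode G y) (comult G a) = counit G a \<odot>\<^bsub>G\<^esub> \<one>\<^bsub>G\<^esub>"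

definition finite_type :: "('k, 'x) ring_scheme \<Rightarrow> ('k, 'a, 'y) module_scheme \<Rightarrow> bool"
  where "finite_type k A \<longleftrightarrow>
    (\<exists>S. finite S \<and> S \<subseteq> carrier A \<and> subalgebra_generated k A S = carrier A)"

text \<open>
  Infinitesimal lifting.  Being a ring homomorphism, \<open>f\<close> is \<open>k\<close>-linear if it agrees with the
  structure maps on scalars.
\<close>

definition formally_smooth ::
  "'u itself \<Rightarrow> ('k, 'x) ring_scheme \<Rightarrow> ('k, 'a, 'y) module_scheme \<Rightarrow> bool"
  where "formally_smooth (_ :: 'u itself) k A \<longleftrightarrow>
    (\<forall>(R :: ('k, 'u) module) I. algebra k R \<longrightarrow> ideal I R \<longrightarrow>
      (\<forall>x\<in>I. \<forall>y\<in>I. x \<otimes>\<^bsub>R\<^esub> y = \<zero>\<^bsub>R\<^esub>) \<longrightarrow>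
      (\<forall>f\<in>ring_hom A (R Quot I).
        (\<forall>c\<in>carrier k. f (c \<odot>\<^bsub>A\<^esub> \<one>\<^bsub>A\<^esub>) = I +>\<^bsub>R\<^esub> (c \<odot>\<^bsub>R\<^esub> \<one>\<^bsub>R\<^esub>)) \<longrightarrow>
        (\<exists>g\<in>algebra_homs k A R. \<forall>a\<in>carrier A. f a = I +>\<^bsub>R\<^esub> g a)))"

definition zariski_closed :: "('a, 'y) ring_scheme \<Rightarrow> 'a set set \<Rightarrow> bool"
  where "zariski_closed A Z \<longleftrightarrow> (\<exists>S\<subseteq>carrier A. Z = {I. primeideal I A \<and> S \<subseteq> I})"

definition connected_spectrum :: "('a, 'y) ring_scheme \<Rightarrow> bool"
  where "connected_spectrum A \<longleftrightarrow>
    {I. primeideal I A} \<noteq> {} \<and>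
    \<not> (\<exists>Y Z. zariski_closed A Y \<and> zariski_closed A Z \<and> Y \<noteq> {} \<and> Z \<noteq> {} \<and>
      Y \<inter> Z = {} \<and> Y \<union> Z = {I. primeideal I A})"

text \<open>Over a field, smooth of finite type means formally smooth of finite type.\<close>

definition linear_algebraic_group ::
  "'u itself \<Rightarrow> ('k, 'x) ring_scheme \<Rightarrow> ('k, 'a) hopf_algebra \<Rightarrow> bool"
  where "linear_algebraic_group U k G \<longleftrightarrow>
    affine_group_scheme k G \<and> finite_type k G \<and> formally_smooth U k G \<and> connected_spectrum G"

text \<open>Homomorphisms of group schemes \<open>Spec H \<rightarrow> Spec G\<close>, as maps of coordinate algebras.\<close>

definition hopf_homs ::
  "('k, 'x) ring_scheme \<Rightarrow> ('k, 'a) hopf_algebra \<Rightarrow> ('k, 'b) hopf_algebra \<Rightarrow> ('a \<Rightarrow> 'b) set"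
  where "hopf_homs k G H = {f \<in> algebra_homs k G H. \<forall>a\<in>carrier G.
    comult H (f a) = tensor_map k H H f f (comult G a) \<and> counit H (f a) = counit G a}"

text \<open>
  The convolution product of \<open>f, g : G \<rightarrow> R\<close>.  On algebra homomorphisms it is the multiplication
  of \<open>R\<close>-points of the group scheme.
\<close>

definition convolution ::
  "('k, 'a) hopf_algebra \<Rightarrow> ('r, 'y) ring_scheme \<Rightarrow> ('a \<Rightarrow> 'r) \<Rightarrow> ('a \<Rightarrow> 'r) \<Rightarrow> 'a \<Rightarrow> 'r"
  where "convolution G R f g =
    (\<lambda>a\<in>carrier G. tensor_lift R (\<lambda>x y. f x \<otimes>\<^bsub>R\<^esub> g y) (comult G a))"

definition conjugate ::
  "('k, 'a) hopf_algebra \<Rightarrow> ('r, 'y) ring_scheme \<Rightarrow> ('a \<Rightarrow> 'r) \<Rightarrow> ('a \<Rightarrow> 'r) \<Rightarrow> 'a \<Rightarrow> 'r"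
  where "conjugate G R g f =
    convolution G R (convolution G R g f) (\<lambda>a. g (antipode G a))"

definition additive_group :: "('k, 'x) ring_scheme \<Rightarrow> ('k, nat \<Rightarrow> 'k) hopf_algebra"
  where "additive_group k = (let A = UP k; T = tensor k A A; t = monom A \<one>\<^bsub>k\<^esub> 1 in
    \<lparr>carrier = carrier A, monoid.mult = monoid.mult A, one = one A, zero = zero A, add = add A,
     smult = module.smult A,
     comult = eval k T (\<lambda>c. c \<odot>\<^bsub>T\<^esub> \<one>\<^bsub>T\<^esub>)
       (pure_tensor k A A t \<one>\<^bsub>A\<^esub> \<oplus>\<^bsub>T\<^esub> pure_tensor k A A \<one>\<^bsub>A\<^esub> t),
     counit = (\<lambda>f. f 0),
     antipode = eval k A (\<lambda>c. monom A c 0) (\<ominus>\<^bsub>A\<^esub> t)\<rparr>)"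

text \<open>The base change of an algebra, and of a group scheme, along the \<open>k\<close>-algebra \<open>K\<close>.\<close>

definition base_change_algebra ::
  "('k, 'x) ring_scheme \<Rightarrow> ('k, 'u) module \<Rightarrow> ('k, 'a, 'y) module_scheme \<Rightarrow>
   ('u, ('u \<times> 'a) list set) module"
  where "base_change_algebra k K A = (let T = tensor k K A in
    \<lparr>carrier = carrier T, monoid.mult = monoid.mult T, one = one T, zero = zero T, add = add T,
     smult = (\<lambda>c X. \<Union>xs\<in>X. tensor_class k K A [(c \<otimes>\<^bsub>K\<^esub> b, a). (b, a) \<leftarrow> xs])\<rparr>)"

definition base_change ::
  "('k, 'x) ring_scheme \<Rightarrow> ('k, 'u) module \<Rightarrow> ('k, 'a) hopf_algebra \<Rightarrow>
   ('u, ('u \<times> 'a) list set) hopf_algebra"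
  where "base_change k K G = (let H = base_change_algebra k K G; T = tensor K H H in
    \<lparr>carrier = carrier H, monoid.mult = monoid.mult H, one = one H, zero = zero H, add = add H,
     smult = module.smult H,
     comult = tensor_lift T (\<lambda>c a. tensor_lift T
       (\<lambda>x y. pure_tensor K H H (pure_tensor k K G c x) (pure_tensor k K G \<one>\<^bsub>K\<^esub> y))
       (comult G a)),
     counit = tensor_lift K (\<lambda>c a. counit G a \<odot>\<^bsub>K\<^esub> c),
     antipode = tensor_lift H (\<lambda>c a. pure_tensor k K G c (antipode G a))\<rparr>)"

text \<open>
  The kernel of the \<open>r\<close>-th Frobenius is cut out by the \<open>p\<^sup>r\<close>-th powers of the functions vanishing
  at the identity.
\<close>

definition frobenius_ideal ::
  "('k, 'x) ring_scheme \<Rightarrow> nat \<Rightarrow> nat \<Rightarrow> ('k, 'a) hopf_algebra \<Rightarrow> 'a set"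
  where "frobenius_ideal k p r G =
    genideal G {a [^]\<^bsub>G\<^esub> (p ^ r) |a. a \<in> carrier G \<and> counit G a = \<zero>\<^bsub>k\<^esub>}"

definition frobenius_kernel ::
  "('k, 'x) ring_scheme \<Rightarrow> nat \<Rightarrow> nat \<Rightarrow> ('k, 'a) hopf_algebra \<Rightarrow> ('k, 'a set) hopf_algebra"
  where "frobenius_kernel k p r G =
    (let J = frobenius_ideal k p r G; Q = quotient_algebra G J; \<pi> = (\<lambda>a. J +>\<^bsub>G\<^esub> a) in
    \<lparr>carrier = carrier Q, monoid.mult = monoid.mult Q, one = one Q, zero = zero Q, add = add Q,
     smult = module.smult Q,
     comult = quotient_map G J (\<lambda>a. tensor_map k Q Q \<pi> \<pi> (comult G a)),
     counit = quotient_map G J (counit G),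
     antipode = quotient_map G J (\<lambda>a. \<pi> (antipode G a))\<rparr>)"

section \<open>The Lie algebra and its p-nilpotent cone\<close>

text \<open>
  Derivations \<open>A \<rightarrow> R\<close> at the identity, that is, elements of \<open>Lie(G) \<otimes> R\<close>.
\<close>

definition point_derivations ::
  "('k, 'x) ring_scheme \<Rightarrow> ('k, 'a) hopf_algebra \<Rightarrow> ('k, 'r, 'y) module_scheme \<Rightarrow> ('a \<Rightarrow> 'r) set"
  where "point_derivations k G R = {D \<in> linear_maps k G R \<inter> extensional (carrier G).
    \<forall>a\<in>carrier G. \<forall>b\<in>carrier G.
      D (a \<otimes>\<^bsub>G\<^esub> b) = counit G a \<odot>\<^bsub>R\<^esub> D b \<oplus>\<^bsub>R\<^esub> counit G b \<odot>\<^bsub>R\<^esub> D a}"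

definition lie_algebra ::
  "('k, 'x) ring_scheme \<Rightarrow> ('k, 'a) hopf_algebra \<Rightarrow> ('a \<Rightarrow> 'k) set"
  where "lie_algebra k G = point_derivations k G (self_algebra k)"

definition lie_zero ::
  "('k, 'x) ring_scheme \<Rightarrow> ('k, 'a) hopf_algebra \<Rightarrow> 'a \<Rightarrow> 'k"
  where "lie_zero k G = (\<lambda>a\<in>carrier G. \<zero>\<^bsub>k\<^esub>)"

definition lie_scale ::
  "('k, 'x) ring_scheme \<Rightarrow> ('k, 'a) hopf_algebra \<Rightarrow> 'k \<Rightarrow> ('a \<Rightarrow> 'k) \<Rightarrow> 'a \<Rightarrow> 'k"
  where "lie_scale k G c B = (\<lambda>a\<in>carrier G. c \<otimes>\<^bsub>k\<^esub> B a)"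

text \<open>
  A left invariant derivation of the coordinate algebra corresponds to its composite with the
  counit; composition of derivations becomes convolution.
\<close>

definition lie_bracket ::
  "('k, 'x) ring_scheme \<Rightarrow> ('k, 'a) hopf_algebra \<Rightarrow> ('a \<Rightarrow> 'k) \<Rightarrow> ('a \<Rightarrow> 'k) \<Rightarrow> 'a \<Rightarrow> 'k"
  where "lie_bracket k G B B' =
    (\<lambda>a\<in>carrier G. convolution G k B B' a \<ominus>\<^bsub>k\<^esub> convolution G k B' B a)"

definition lie_p_power ::
  "('k, 'x) ring_scheme \<Rightarrow> nat \<Rightarrow> ('k, 'a) hopf_algebra \<Rightarrow> ('a \<Rightarrow> 'k) \<Rightarrow> 'a \<Rightarrow> 'k"
  where "lie_p_power k p G B = (convolution G k B ^^ p) (restrict (counit G) (carrier G))"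

definition p_nilpotents ::
  "('k, 'x) ring_scheme \<Rightarrow> nat \<Rightarrow> ('k, 'a) hopf_algebra \<Rightarrow> ('a \<Rightarrow> 'k) set"
  where "p_nilpotents k p G = {B \<in> lie_algebra k G. lie_p_power k p G B = lie_zero k G}"

definition commuting_tuples ::
  "('k, 'x) ring_scheme \<Rightarrow> nat \<Rightarrow> ('k, 'a) hopf_algebra \<Rightarrow> nat \<Rightarrow> ('a \<Rightarrow> 'k) list set"
  where "commuting_tuples k p G r = {Bs. length Bs = r \<and> set Bs \<subseteq> p_nilpotents k p G \<and>
    (\<forall>B\<in>set Bs. \<forall>B'\<in>set Bs. lie_bracket k G B B' = lie_zero k G)}"

text \<open>
  \<open>P\<close> is the coordinate algebra of the p-nilpotent cone, the reduced closed subscheme of the affine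
  space \<open>Lie(G)\<close> whose \<open>K\<close>-points are the p-nilpotent elements of \<open>Lie(G\<^sub>K)\<close>, for all field
  extensions \<open>K\<close> of \<open>k\<close>.  The inclusion into \<open>Lie(G)\<close> is a \<open>P\<close>-point \<open>u\<close> of \<open>Lie(G)\<close>; it is a closed
  immersion iff the values of \<open>u\<close> generate \<open>P\<close>.  A \<open>K\<close>-point \<open>\<phi> : P \<rightarrow> K\<close> of the cone is the
  derivation \<open>\<phi> \<circ> u\<close>, extended to \<open>K \<otimes> G\<close>.
\<close>

definition point_of_cone ::
  "('k, 'x) ring_scheme \<Rightarrow> ('k, 'a) hopf_algebra \<Rightarrow> ('k, 'n) module \<Rightarrow> ('a \<Rightarrow> 'n) \<Rightarrow>
   ('k, 'u) module \<Rightarrow> (('u \<times> 'a) list set \<Rightarrow> 'u) \<Rightarrow> ('n \<Rightarrow> 'u) \<Rightarrow> bool"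
  where "point_of_cone k G P u K B \<phi> \<longleftrightarrow>
    \<phi> \<in> algebra_homs k P K \<inter> extensional (carrier P) \<and>
    (\<forall>a\<in>carrier G. \<phi> (u a) = B (pure_tensor k K G \<one>\<^bsub>K\<^esub> a))"

definition p_nilpotent_cone ::
  "'u itself \<Rightarrow> ('k, 'x) ring_scheme \<Rightarrow> nat \<Rightarrow> ('k, 'a) hopf_algebra \<Rightarrow>
   ('k, 'n) module \<Rightarrow> ('a \<Rightarrow> 'n) \<Rightarrow> bool"
  where "p_nilpotent_cone (_ :: 'u itself) k p G P u \<longleftrightarrow>
    algebra k P \<and>
    (\<forall>x\<in>carrier P. \<forall>n::nat. x [^]\<^bsub>P\<^esub> n = \<zero>\<^bsub>P\<^esub> \<longrightarrow> x = \<zero>\<^bsub>P\<^esub>) \<and>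
    u \<in> point_derivations k G P \<and>
    subalgebra_generated k P (u ` carrier G) = carrier P \<and>
    (\<forall>K :: ('k, 'u) module. algebra k K \<longrightarrow> field K \<longrightarrow>
      (\<forall>B\<in>lie_algebra K (base_change k K G).
        B \<in> p_nilpotents K p (base_change k K G) \<longleftrightarrow> (\<exists>\<phi>. point_of_cone k G P u K B \<phi>)))"

section \<open>Structures of exponential type\<close>

text \<open>
  A morphism from the product of the p-nilpotent cone and the affine line to the group is given
  by its comorphism \<open>E : G \<rightarrow> P[t]\<close>.  For a p-nilpotent \<open>B\<close> over \<open>K\<close>, \<open>exp_map\<close> is the comorphism
  \<open>K \<otimes> G \<rightarrow> K[t]\<close> of \<open>s \<mapsto> E\<^sub>B(s)\<close>.
\<close>

definition exp_map ::
  "('k, 'x) ring_scheme \<Rightarrow> ('k, 'a) hopf_algebra \<Rightarrow> ('k, 'n) module \<Rightarrow> ('a \<Rightarrow> 'n) \<Rightarrow>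
   ('a \<Rightarrow> nat \<Rightarrow> 'n) \<Rightarrow> ('k, 'u) module \<Rightarrow> (('u \<times> 'a) list set \<Rightarrow> 'u) \<Rightarrow>
   ('u \<times> 'a) list set \<Rightarrow> nat \<Rightarrow> 'u"
  where "exp_map k G P u E K B = (let \<phi> = (THE \<phi>. point_of_cone k G P u K B \<phi>) in
    (\<lambda>X\<in>carrier (base_change k K G).
      tensor_lift (UP K) (\<lambda>c a. c \<odot>\<^bsub>UP K\<^esub> (\<lambda>n. \<phi> (E a n))) X))"

text \<open>The comorphism \<open>t \<mapsto> t\<^bsup>q\<^esup>\<close>, for \<open>q = p\<^sup>i\<close>, of the \<open>i\<close>-th power of the Frobenius of the affine line.\<close>

definition frobenius_pullback ::
  "('k, 'x) ring_scheme \<Rightarrow> nat \<Rightarrow> nat \<Rightarrow> (nat \<Rightarrow> 'k) \<Rightarrow> nat \<Rightarrow> 'k"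
  where "frobenius_pullback k p i =
    eval k (UP k) (\<lambda>c. monom (UP k) c 0) (monom (UP k) \<one>\<^bsub>k\<^esub> (p ^ i))"

text \<open>
  The product over \<open>i < length Bs\<close> of the composites of \<open>E\<^bsub>Bs!i\<^esub>\<close> with the \<open>i\<close>-th power of Frobenius,
  formed in the group of morphisms from the affine line to \<open>G\<^sub>K\<close>.
\<close>

definition exp_product ::
  "('k, 'x) ring_scheme \<Rightarrow> nat \<Rightarrow> ('k, 'a) hopf_algebra \<Rightarrow> ('k, 'n) module \<Rightarrow> ('a \<Rightarrow> 'n) \<Rightarrow>
   ('a \<Rightarrow> nat \<Rightarrow> 'n) \<Rightarrow> ('k, 'u) module \<Rightarrow> (('u \<times> 'a) list set \<Rightarrow> 'u) list \<Rightarrow>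
   ('u \<times> 'a) list set \<Rightarrow> nat \<Rightarrow> 'u"
  where "exp_product k p G P u E K Bs = (let H = base_change k K G in
    foldr (\<lambda>i. convolution H (UP K)
        (\<lambda>X. frobenius_pullback K p i (exp_map k G P u E K (Bs ! i) X)))
      [0..<length Bs] (\<lambda>X\<in>carrier H. monom (UP K) (counit H X) 0))"

text \<open>
  Equivariance for the adjoint action on the cone, the trivial action on the affine line and
  conjugation on the group, on \<open>R\<close>-points: if \<open>x' = Ad(g) x\<close> then \<open>E(x', s) = g E(x, s) g\<^sup>-\<^sup>1\<close>.
\<close>

definition exp_equivariant ::
  "'u itself \<Rightarrow> ('k, 'x) ring_scheme \<Rightarrow> ('k, 'a) hopf_algebra \<Rightarrow> ('k, 'n) module \<Rightarrow>
   ('a \<Rightarrow> 'n) \<Rightarrow> ('a \<Rightarrow> nat \<Rightarrow> 'n) \<Rightarrow> bool"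
  where "exp_equivariant (_ :: 'u itself) k G P u E \<longleftrightarrow>
    (\<forall>R :: ('k, 'u) module. algebra k R \<longrightarrow>
      (\<forall>g\<in>algebra_homs k G R. \<forall>x\<in>algebra_homs k P R. \<forall>x'\<in>algebra_homs k P R.
        (\<forall>a\<in>carrier G. x' (u a) = conjugate G R g (\<lambda>b. x (u b)) a) \<longrightarrow>
        (\<forall>s\<in>carrier R. \<forall>a\<in>carrier G.
          eval P R x' s (E a) = conjugate G R g (\<lambda>b. eval P R x s (E b)) a)))"

locale exponential_type =
  fixes U :: "'u itself"
    and k :: "('k, 'x) ring_scheme"
    and p :: nat
    and G :: "('k, 'a) hopf_algebra"
    and P :: "('k, 'n) module"
    and u :: "'a \<Rightarrow> 'n"
    and E :: "'a \<Rightarrow> nat \<Rightarrow> 'n"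
  assumes cone: "p_nilpotent_cone U k p G P u"
    and morphism: "E \<in> algebra_homs k G (poly_algebra P)"
    and equivariant: "exp_equivariant U k G P u E"
    and one_parameter: "\<And>(K :: ('k, 'u) module) B. algebra k K \<Longrightarrow> field K \<Longrightarrow>
      B \<in> p_nilpotents K p (base_change k K G) \<Longrightarrow>
      exp_map k G P u E K B \<in> hopf_homs K (base_change k K G) (additive_group K)"
    and commute: "\<And>(K :: ('k, 'u) module) B B' X. algebra k K \<Longrightarrow> field K \<Longrightarrow>
      B \<in> p_nilpotents K p (base_change k K G) \<Longrightarrow>
      B' \<in> p_nilpotents K p (base_change k K G) \<Longrightarrow>
      lie_bracket K (base_change k K G) B B' = lie_zero K (base_change k K G) \<Longrightarrow>
      X \<in> carrier (base_change k K G) \<Longrightarrow>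
      tensor_map K (UP K) (UP K) (exp_map k G P u E K B) (exp_map k G P u E K B')
        (comult (base_change k K G) X) =
      tensor_swap K (UP K) (UP K)
        (tensor_map K (UP K) (UP K) (exp_map k G P u E K B') (exp_map k G P u E K B)
          (comult (base_change k K G) X))"
    and scale: "\<And>(K :: ('k, 'u) module) B c s X. algebra k K \<Longrightarrow> field K \<Longrightarrow>
      B \<in> p_nilpotents K p (base_change k K G) \<Longrightarrow> c \<in> carrier K \<Longrightarrow> s \<in> carrier K \<Longrightarrow>
      X \<in> carrier (base_change k K G) \<Longrightarrow>
      eval K K (\<lambda>x. x) s (exp_map k G P u E K (lie_scale K (base_change k K G) c B) X) =
      eval K K (\<lambda>x. x) (c \<otimes>\<^bsub>K\<^esub> s) (exp_map k G P u E K B X)"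
    and every_one_parameter: "\<And>(K :: ('k, 'u) module) \<psi>. algebra k K \<Longrightarrow> field K \<Longrightarrow>
      \<psi> \<in> hopf_homs K (base_change k K G) (additive_group K) \<Longrightarrow>
      \<exists>r>0. \<exists>Bs\<in>commuting_tuples K p (base_change k K G) r.
        \<forall>X\<in>carrier (base_change k K G). \<psi> X = exp_product k p G P u E K Bs X"
    and infinitesimal: "\<And>(K :: ('k, 'u) module) r. algebra k K \<Longrightarrow> field K \<Longrightarrow> r > 0 \<Longrightarrow>
      bij_betw
        (\<lambda>Bs. quotient_map (base_change k K G) (frobenius_ideal K p r (base_change k K G))
          (\<lambda>X. frobenius_ideal K p r (additive_group K)
            +>\<^bsub>additive_group K\<^esub> exp_product k p G P u E K Bs X))
        (commuting_tuples K p (base_change k K G) r)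
        (hopf_homs K (frobenius_kernel K p r (base_change k K G))
            (frobenius_kernel K p r (additive_group K)) \<inter>
          extensional (carrier (frobenius_kernel K p r (base_change k K G))))"

section \<open>Modules and their filtrations\<close>

text \<open>\<open>M\<close> need not be finite-dimensional; its ring operations \<open>mult\<close> and \<open>one\<close> are not used.\<close>

locale group_module =
  fixes k :: "('k, 'x) ring_scheme"
    and G :: "('k, 'a) hopf_algebra"
    and M :: "('k, 'm) module"
    and \<rho> :: "'m \<Rightarrow> ('m \<times> 'a) list set"
  assumes vector_space: "module k M"
    and coaction_linear: "\<rho> \<in> linear_maps k M (tensor k M G)"
    and coaction_coassociative: "\<And>m. m \<in> carrier M \<Longrightarrow>
      tensor_assoc k M G G (tensor_map k (tensor k M G) G \<rho> (\<lambda>a. a) (\<rho> m)) =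
      tensor_map k M (tensor k G G) (\<lambda>x. x) (comult G) (\<rho> m)"
    and coaction_counit: "\<And>m. m \<in> carrier M \<Longrightarrow>
      tensor_lift M (\<lambda>x a. counit G a \<odot>\<^bsub>M\<^esub> x) (\<rho> m) = m"

definition group_submodule ::
  "('k, 'x) ring_scheme \<Rightarrow> ('k, 'a) hopf_algebra \<Rightarrow> ('k, 'm) module \<Rightarrow>
   ('m \<Rightarrow> ('m \<times> 'a) list set) \<Rightarrow> 'm set \<Rightarrow> bool"
  where "group_submodule k G M \<rho> N \<longleftrightarrow>
    submodule N k M \<and> (\<forall>m\<in>N. \<rho> m \<in> tensor_image k M G N (carrier G))"

text \<open>The submodule \<open>N\<close> is an \<open>X\<close>-comodule: its coaction factors through \<open>N \<otimes> X\<close>.\<close>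

definition comodule_for ::
  "('k, 'x) ring_scheme \<Rightarrow> ('k, 'a) hopf_algebra \<Rightarrow> ('k, 'm) module \<Rightarrow>
   ('m \<Rightarrow> ('m \<times> 'a) list set) \<Rightarrow> 'a set \<Rightarrow> 'm set \<Rightarrow> bool"
  where "comodule_for k G M \<rho> X N \<longleftrightarrow>
    group_submodule k G M \<rho> N \<and> (\<forall>m\<in>N. \<rho> m \<in> tensor_image k M G N X)"

definition comodule_part ::
  "('k, 'x) ring_scheme \<Rightarrow> ('k, 'a) hopf_algebra \<Rightarrow> ('k, 'm) module \<Rightarrow>
   ('m \<Rightarrow> ('m \<times> 'a) list set) \<Rightarrow> 'a set \<Rightarrow> 'm set"
  where "comodule_part k G M \<rho> X = \<Union>{N. comodule_for k G M \<rho> X N}"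

definition exp_degree_functions ::
  "('k, 'a) hopf_algebra \<Rightarrow> ('k, 'n) module \<Rightarrow> ('a \<Rightarrow> nat \<Rightarrow> 'n) \<Rightarrow> nat \<Rightarrow> 'a set"
  where "exp_degree_functions G P E d =
    {a \<in> carrier G. E a \<in> carrier (UP P) \<and> deg P (E a) \<le> d}"

definition exp_degree_part ::
  "('k, 'x) ring_scheme \<Rightarrow> ('k, 'a) hopf_algebra \<Rightarrow> ('k, 'n) module \<Rightarrow> ('a \<Rightarrow> nat \<Rightarrow> 'n) \<Rightarrow>
   ('k, 'm) module \<Rightarrow> ('m \<Rightarrow> ('m \<times> 'a) list set) \<Rightarrow> nat \<Rightarrow> 'm set"
  where "exp_degree_part k G P E M \<rho> d = {m \<in> carrier M.
    \<rho> m \<in> tensor_image k M G (carrier M) (exp_degree_functions G P E d)}"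

definition submodule_filtration ::
  "('k, 'x) ring_scheme \<Rightarrow> ('k, 'a) hopf_algebra \<Rightarrow> ('k, 'm) module \<Rightarrow>
   ('m \<Rightarrow> ('m \<times> 'a) list set) \<Rightarrow> (nat \<Rightarrow> 'm set) \<Rightarrow> bool"
  where "submodule_filtration k G M \<rho> N \<longleftrightarrow> (\<forall>d. group_submodule k G M \<rho> (N d)) \<and> mono N"

end

theory Submission
  imports Defs "HOL-Library.Multiset"
begin

text \<open>
  Write \<open>k[G]\<close> for the coordinate algebra and \<open>X\<^sub>d\<close> for the space of functions of exponential
  degree at most \<open>d\<close>.  The \<open>X\<^sub>d\<close> are subspaces, because \<open>E\<close> is linear and a degree bound on a
  polynomial is the vanishing of its higher coefficients; they increase with \<open>d\<close>, and they exhaust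
  \<open>k[G]\<close> because each polynomial has a degree.

  The sum of two \<open>X\<close>-comodules in \<open>M\<close> is again one, so the union \<open>M\<^sub>X\<close> is a submodule; the
  inclusion of \<open>M\<^sub>X\<close> in the part of exponential degree at most \<open>d\<close> only forgets that the first
  tensor factors lie in the subcomodule.

  The union over \<open>d\<close> is \<open>M\<close> because comodules are locally finite (\<open>local_finiteness\<close>): each element
  lies in a subcomodule spanned by finitely many vectors, the coaction on these vectors involves
  finitely many functions, and one \<open>X\<^sub>d\<close> contains all of them (\<open>comodule_parts_exhaust\<close>).

  The filtration is the coarsest one because a submodule \<open>N\<close> on which the coaction takes values in
  \<open>M \<otimes> X\<close> has coaction in \<open>(N \<otimes> k[G]) \<inter> (M \<otimes> X) = N \<otimes> X\<close> (\<open>tensor_image_Int\<close>), hence is an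
  \<open>X\<close>-comodule and is contained in \<open>M\<^sub>X\<close>.

  Both arguments compare two expressions of one tensor by contracting it with linear functionals
  that are dual to the components of a representation of minimal length.  This makes the bulk of the
  work the calculus of tensor products as modules and of linear maps out of them, together with the
  existence of functionals that separate a vector from a subspace.
\<close>

section \<open>The tensor product of two modules\<close>

lemma (in module) smult_commute:
  assumes "a \<in> carrier R" and "b \<in> carrier R" and "x \<in> carrier M"
  shows "a \<odot>\<^bsub>M\<^esub> (b \<odot>\<^bsub>M\<^esub> x) = b \<odot>\<^bsub>M\<^esub> (a \<odot>\<^bsub>M\<^esub> x)"
  using assms by (metis R.m_comm smult_assoc1)

locale module_pair = M: module R M + N: module R N
  for R :: "('r, 'x) ring_scheme" and M :: "('r, 'm, 'y) module_scheme"
    and N :: "('r, 'n, 'z) module_scheme"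
begin

abbreviation formal_sums :: "('m \<times> 'n) list set"
  where "formal_sums \<equiv> {xs. set xs \<subseteq> carrier M \<times> carrier N}"

lemma tensor_eq_carrier:
  assumes "tensor_eq R M N xs ys"
  shows "set xs \<subseteq> carrier M \<times> carrier N \<and> set ys \<subseteq> carrier M \<times> carrier N"
  using assms by induction auto

lemma tensor_class_eq_iff:
  assumes "set xs \<subseteq> carrier M \<times> carrier N"
  shows "tensor_class R M N xs = tensor_class R M N ys \<longleftrightarrow> tensor_eq R M N xs ys"
  using assms unfolding tensor_class_def
  by (blast intro: tensor_eq.refl tensor_eq.sym tensor_eq.trans)

lemma tensor_class_eqI:
  "tensor_eq R M N xs ys \<Longrightarrow> tensor_class R M N xs = tensor_class R M N ys"
  using tensor_class_eq_iff tensor_eq_carrier by blast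

lemma tensor_class_self:
  "set xs \<subseteq> carrier M \<times> carrier N \<Longrightarrow> xs \<in> tensor_class R M N xs"
  unfolding tensor_class_def by (blast intro: tensor_eq.refl)

lemma tensor_class_memD: "ys \<in> tensor_class R M N xs \<Longrightarrow> tensor_eq R M N xs ys"
  by (simp add: tensor_class_def)

text \<open>
  The order of the summands is irrelevant: commutation of two adjacent blocks already generates all
  permutations.
\<close>

lemma tensor_eq_mset:
  assumes "mset xs = mset ys" and "set xs \<subseteq> carrier M \<times> carrier N"
  shows "tensor_eq R M N xs ys"
  using assms
proof (induction xs arbitrary: ys)
  case Nil
  then have "ys = []" by simp
  then show ?case by (simp add: tensor_eq.refl)
next
  case (Cons x xs)
  then have "x \<in> set ys"
    by (metis list.set_intros(1) set_mset_mset)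
  then obtain as bs where ys: "ys = as @ x # bs"
    by (meson split_list)
  then have m: "mset xs = mset (as @ bs)" using Cons.prems(1) by simp
  then have "set xs = set (as @ bs)" by (metis set_mset_mset)
  then have s: "set ([x] @ as) \<subseteq> carrier M \<times> carrier N" "set bs \<subseteq> carrier M \<times> carrier N"
    using Cons.prems(2) by auto
  have "tensor_eq R M N ([x] @ xs) ([x] @ (as @ bs))"
    using Cons m by (intro tensor_eq.append tensor_eq.refl Cons.IH) auto
  moreover have "tensor_eq R M N (([x] @ as) @ bs) ((as @ [x]) @ bs)"
    using s by (intro tensor_eq.append tensor_eq.comm tensor_eq.refl)
  ultimately show ?case
    unfolding ys by (auto intro: tensor_eq.trans)
qed

lemma tensor_add_class:
  assumes "set xs \<subseteq> carrier M \<times> carrier N" and "set ys \<subseteq> carrier M \<times> carrier N"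
  shows "tensor_class R M N xs \<oplus>\<^bsub>tensor R M N\<^esub> tensor_class R M N ys = tensor_class R M N (xs @ ys)"
proof -
  have "tensor_class R M N (xs' @ ys') = tensor_class R M N (xs @ ys)"
    if "xs' \<in> tensor_class R M N xs" "ys' \<in> tensor_class R M N ys" for xs' ys'
    using that by (metis tensor_class_eqI tensor_class_memD tensor_eq.append)
  then have "(\<Union>xs'\<in>tensor_class R M N xs. \<Union>ys'\<in>tensor_class R M N ys. tensor_class R M N (xs' @ ys')) =
      (\<Union>xs'\<in>tensor_class R M N xs. \<Union>ys'\<in>tensor_class R M N ys. tensor_class R M N (xs @ ys))"
    by (intro SUP_cong HOL.refl)
  also have "\<dots> = tensor_class R M N (xs @ ys)"
    using tensor_class_self[OF assms(1)] tensor_class_self[OF assms(2)]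
    by blast
  finally show ?thesis by (simp add: tensor_def)
qed

lemma tensor_eq_smult_left:
  assumes "tensor_eq R M N xs ys" and c: "c \<in> carrier R"
  shows "tensor_eq R M N (map (\<lambda>(m, n). (c \<odot>\<^bsub>M\<^esub> m, n)) xs) (map (\<lambda>(m, n). (c \<odot>\<^bsub>M\<^esub> m, n)) ys)"
  using assms(1)
proof induction
  case (refl xs)
  then show ?case using c by (intro tensor_eq.refl) auto
next
  case (comm xs ys)
  then show ?case using c by (simp only: map_append, intro tensor_eq.comm) auto
next
  case (add_left m m' n)
  then show ?case using c by (simp add: M.smult_r_distr tensor_eq.add_left)
next
  case (smult d m n)
  have "c \<odot>\<^bsub>M\<^esub> (d \<odot>\<^bsub>M\<^esub> m) = d \<odot>\<^bsub>M\<^esub> (c \<odot>\<^bsub>M\<^esub> m)"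
    using smult c by (simp add: M.smult_commute)
  then show ?case using smult c by (simp add: tensor_eq.smult)
qed (use c in \<open>auto intro: tensor_eq.intros\<close>)

lemma tensor_smult_class:
  assumes "set xs \<subseteq> carrier M \<times> carrier N" and "c \<in> carrier R"
  shows "c \<odot>\<^bsub>tensor R M N\<^esub> tensor_class R M N xs =
    tensor_class R M N (map (\<lambda>(m, n). (c \<odot>\<^bsub>M\<^esub> m, n)) xs)"
proof -
  have "tensor_class R M N (map (\<lambda>(m, n). (c \<odot>\<^bsub>M\<^esub> m, n)) xs') =
      tensor_class R M N (map (\<lambda>(m, n). (c \<odot>\<^bsub>M\<^esub> m, n)) xs)"
    if "xs' \<in> tensor_class R M N xs" for xs'
    using that assms(2) by (metis tensor_class_eqI tensor_class_memD tensor_eq_smult_left)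
  then have "(\<Union>xs'\<in>tensor_class R M N xs.
        tensor_class R M N (map (\<lambda>(m, n). (c \<odot>\<^bsub>M\<^esub> m, n)) xs')) =
      (\<Union>xs'\<in>tensor_class R M N xs. tensor_class R M N (map (\<lambda>(m, n). (c \<odot>\<^bsub>M\<^esub> m, n)) xs))"
    by (intro SUP_cong HOL.refl)
  also have "\<dots> = tensor_class R M N (map (\<lambda>(m, n). (c \<odot>\<^bsub>M\<^esub> m, n)) xs)"
    using tensor_class_self[OF assms(1)] by blast
  finally show ?thesis by (simp add: tensor_def)
qed

lemma carrier_tensor: "carrier (tensor R M N) = tensor_class R M N ` formal_sums"
  by (simp add: tensor_def)

lemma zero_tensor: "\<zero>\<^bsub>tensor R M N\<^esub> = tensor_class R M N []"
  by (simp add: tensor_def)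

lemma tensor_class_closed:
  "set xs \<subseteq> carrier M \<times> carrier N \<Longrightarrow> tensor_class R M N xs \<in> carrier (tensor R M N)"
  by (simp add: carrier_tensor)

lemma tensor_cases:
  assumes "z \<in> carrier (tensor R M N)"
  obtains xs where "set xs \<subseteq> carrier M \<times> carrier N" and "z = tensor_class R M N xs"
  using assms by (auto simp: carrier_tensor)

text \<open>
  Only \<open>0 \<otimes> 0 = 0\<close> is imposed; \<open>0 \<otimes> n = (0 \<cdot> 0) \<otimes> n = 0 \<otimes> 0 \<cdot> n\<close> reduces to it.
\<close>

lemma tensor_eq_zero_left:
  assumes "n \<in> carrier N"
  shows "tensor_eq R M N [(\<zero>\<^bsub>M\<^esub>, n)] []"
proof -
  have "tensor_eq R M N [(\<zero>\<^bsub>R\<^esub> \<odot>\<^bsub>M\<^esub> \<zero>\<^bsub>M\<^esub>, n)] [(\<zero>\<^bsub>M\<^esub>, \<zero>\<^bsub>R\<^esub> \<odot>\<^bsub>N\<^esub> n)]"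
    using assms by (intro tensor_eq.smult) auto
  then show ?thesis
    using assms tensor_eq.zero by (auto intro: tensor_eq.trans)
qed

text \<open>
  The congruence is generated inside a free commutative monoid; negatives nevertheless exist in the
  quotient because the first factor has them.
\<close>

lemma tensor_eq_neg:
  assumes "set xs \<subseteq> carrier M \<times> carrier N"
  shows "tensor_eq R M N (map (\<lambda>(m, n). (\<ominus>\<^bsub>M\<^esub> m, n)) xs @ xs) []"
  using assms
proof (induction xs)
  case Nil
  then show ?case by (simp add: tensor_eq.refl)
next
  case (Cons x xs)
  obtain m n where x: "x = (m, n)" by (cases x)
  have mn: "m \<in> carrier M" "n \<in> carrier N" using Cons.prems x by auto
  let ?neg = "map (\<lambda>(m, n). (\<ominus>\<^bsub>M\<^esub> m, n))"
  have "tensor_eq R M N [(\<ominus>\<^bsub>M\<^esub> m, n), (m, n)] [(\<ominus>\<^bsub>M\<^esub> m \<oplus>\<^bsub>M\<^esub> m, n)]"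
    using mn by (intro tensor_eq.sym[OF tensor_eq.add_left]) auto
  then have "tensor_eq R M N [(\<ominus>\<^bsub>M\<^esub> m, n), (m, n)] []"
    using mn tensor_eq_zero_left by (auto simp: M.l_neg intro: tensor_eq.trans)
  then have "tensor_eq R M N ([(\<ominus>\<^bsub>M\<^esub> m, n), (m, n)] @ (?neg xs @ xs)) ([] @ [])"
    using Cons by (intro tensor_eq.append) auto
  moreover have "tensor_eq R M N (?neg (x # xs) @ x # xs)
      ([(\<ominus>\<^bsub>M\<^esub> m, n), (m, n)] @ (?neg xs @ xs))"
    using Cons.prems x by (intro tensor_eq_mset) auto
  ultimately show ?case by (auto intro: tensor_eq.trans)
qed

lemma tensor_eq_smult_l_distr:
  assumes "set xs \<subseteq> carrier M \<times> carrier N" and c: "a \<in> carrier R" "b \<in> carrier R"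
  shows "tensor_eq R M N (map (\<lambda>(m, n). ((a \<oplus>\<^bsub>R\<^esub> b) \<odot>\<^bsub>M\<^esub> m, n)) xs)
    (map (\<lambda>(m, n). (a \<odot>\<^bsub>M\<^esub> m, n)) xs @ map (\<lambda>(m, n). (b \<odot>\<^bsub>M\<^esub> m, n)) xs)"
  using assms(1)
proof (induction xs)
  case Nil
  then show ?case by (simp add: tensor_eq.refl)
next
  case (Cons x xs)
  obtain m n where x: "x = (m, n)" by (cases x)
  have mn: "m \<in> carrier M" "n \<in> carrier N" using Cons.prems x by auto
  let ?s = "\<lambda>c. map (\<lambda>(m, n). (c \<odot>\<^bsub>M\<^esub> m, n))"
  have "tensor_eq R M N ([((a \<oplus>\<^bsub>R\<^esub> b) \<odot>\<^bsub>M\<^esub> m, n)] @ ?s (a \<oplus>\<^bsub>R\<^esub> b) xs)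
      ([(a \<odot>\<^bsub>M\<^esub> m, n), (b \<odot>\<^bsub>M\<^esub> m, n)] @ ?s a xs @ ?s b xs)"
    using Cons mn c by (intro tensor_eq.append) (auto simp: M.smult_l_distr tensor_eq.add_left)
  moreover have "tensor_eq R M N ([(a \<odot>\<^bsub>M\<^esub> m, n), (b \<odot>\<^bsub>M\<^esub> m, n)] @ ?s a xs @ ?s b xs)
      (?s a (x # xs) @ ?s b (x # xs))"
    using Cons.prems x c by (intro tensor_eq_mset) auto
  ultimately show ?case using x by (auto intro: tensor_eq.trans)
qed

text \<open>
  As tensor products are again modules, they can be iterated, and can be targets of bilinear maps;
  this is how the associativity isomorphism is handled below.
\<close>

lemma tensor_module: "module R (tensor R M N)"
proof (rule moduleI)
  let ?T = "tensor R M N"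
  note cl = tensor_add_class tensor_smult_class tensor_class_closed zero_tensor
  show "cring R" by (rule M.R.is_cring)
  show "abelian_group ?T"
  proof (rule abelian_groupI)
    fix x y z assume "x \<in> carrier ?T" "y \<in> carrier ?T" "z \<in> carrier ?T"
    then show "x \<oplus>\<^bsub>?T\<^esub> y \<oplus>\<^bsub>?T\<^esub> z = x \<oplus>\<^bsub>?T\<^esub> (y \<oplus>\<^bsub>?T\<^esub> z)"
      by (elim tensor_cases) (auto simp: cl)
  next
    fix x y assume "x \<in> carrier ?T" "y \<in> carrier ?T"
    then show "x \<oplus>\<^bsub>?T\<^esub> y \<in> carrier ?T"
      by (elim tensor_cases) (simp add: cl)
  next
    fix x y assume "x \<in> carrier ?T" "y \<in> carrier ?T"
    then show "x \<oplus>\<^bsub>?T\<^esub> y = y \<oplus>\<^bsub>?T\<^esub> x"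
      by (elim tensor_cases) (simp add: cl tensor_class_eqI tensor_eq.comm)
  next
    fix x assume "x \<in> carrier ?T"
    then show "\<zero>\<^bsub>?T\<^esub> \<oplus>\<^bsub>?T\<^esub> x = x"
      by (elim tensor_cases) (simp add: cl)
  next
    fix x assume "x \<in> carrier ?T"
    then obtain xs where xs: "set xs \<subseteq> carrier M \<times> carrier N" "x = tensor_class R M N xs"
      by (rule tensor_cases)
    let ?neg = "map (\<lambda>(m, n). (\<ominus>\<^bsub>M\<^esub> m, n)) xs"
    have "set ?neg \<subseteq> carrier M \<times> carrier N" using xs(1) by auto
    then show "\<exists>y\<in>carrier ?T. y \<oplus>\<^bsub>?T\<^esub> x = \<zero>\<^bsub>?T\<^esub>"
      using xs tensor_class_eqI[OF tensor_eq_neg[OF xs(1)]]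
      by (intro bexI[of _ "tensor_class R M N ?neg"]) (simp_all add: cl)
  qed (simp add: cl)
  have smult_closed: "set (map (\<lambda>(m, n). (c \<odot>\<^bsub>M\<^esub> m, n)) xs) \<subseteq> carrier M \<times> carrier N"
    if "c \<in> carrier R" "set xs \<subseteq> carrier M \<times> carrier N" for c xs
    using that by auto
  fix a x assume a: "a \<in> carrier R" and x: "x \<in> carrier ?T"
  show "a \<odot>\<^bsub>?T\<^esub> x \<in> carrier ?T"
    using x a smult_closed by (elim tensor_cases) (simp add: cl)
  fix b assume b: "b \<in> carrier R"
  show "(a \<oplus>\<^bsub>R\<^esub> b) \<odot>\<^bsub>?T\<^esub> x = a \<odot>\<^bsub>?T\<^esub> x \<oplus>\<^bsub>?T\<^esub> b \<odot>\<^bsub>?T\<^esub> x"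
    using x
  proof (rule tensor_cases)
    fix xs assume xs: "set xs \<subseteq> carrier M \<times> carrier N" "x = tensor_class R M N xs"
    show ?thesis
      using xs smult_closed[OF a xs(1)] smult_closed[OF b xs(1)] a b
        tensor_class_eqI[OF tensor_eq_smult_l_distr[OF xs(1) a b]]
      by (simp add: cl)
  qed
  show "(a \<otimes>\<^bsub>R\<^esub> b) \<odot>\<^bsub>?T\<^esub> x = a \<odot>\<^bsub>?T\<^esub> (b \<odot>\<^bsub>?T\<^esub> x)"
    using x
  proof (rule tensor_cases)
    fix xs assume xs: "set xs \<subseteq> carrier M \<times> carrier N" "x = tensor_class R M N xs"
    have "map (\<lambda>(m, n). ((a \<otimes>\<^bsub>R\<^esub> b) \<odot>\<^bsub>M\<^esub> m, n)) xs =
        map (\<lambda>(m, n). (a \<odot>\<^bsub>M\<^esub> m, n)) (map (\<lambda>(m, n). (b \<odot>\<^bsub>M\<^esub> m, n)) xs)"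
      using xs(1) a b by (auto simp: M.smult_assoc1)
    then show ?thesis
      using xs smult_closed[OF b xs(1)] a b by (simp add: cl del: map_map)
  qed
next
  let ?T = "tensor R M N"
  fix a x y assume a: "a \<in> carrier R" and x: "x \<in> carrier ?T" and y: "y \<in> carrier ?T"
  obtain xs where xs: "set xs \<subseteq> carrier M \<times> carrier N" "x = tensor_class R M N xs"
    using x by (rule tensor_cases)
  obtain ys where ys: "set ys \<subseteq> carrier M \<times> carrier N" "y = tensor_class R M N ys"
    using y by (rule tensor_cases)
  have "set (map (\<lambda>(m, n). (a \<odot>\<^bsub>M\<^esub> m, n)) zs) \<subseteq> carrier M \<times> carrier N"
    if "set zs \<subseteq> carrier M \<times> carrier N" for zs using that a by auto
  then show "a \<odot>\<^bsub>?T\<^esub> (x \<oplus>\<^bsub>?T\<^esub> y) = a \<odot>\<^bsub>?T\<^esub> x \<oplus>\<^bsub>?T\<^esub> a \<odot>\<^bsub>?T\<^esub> y"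
    using xs ys a by (simp add: tensor_add_class tensor_smult_class)
next
  fix x assume x: "x \<in> carrier (tensor R M N)"
  then obtain xs where xs: "set xs \<subseteq> carrier M \<times> carrier N" "x = tensor_class R M N xs"
    by (rule tensor_cases)
  have "map (\<lambda>(m, n). (\<one>\<^bsub>R\<^esub> \<odot>\<^bsub>M\<^esub> m, n)) xs = xs"
    using xs(1) by (intro map_idI) auto
  then show "\<one>\<^bsub>R\<^esub> \<odot>\<^bsub>tensor R M N\<^esub> x = x"
    using xs by (simp add: tensor_smult_class)
qed

lemma pure_tensor_closed:
  "m \<in> carrier M \<Longrightarrow> n \<in> carrier N \<Longrightarrow> pure_tensor R M N m n \<in> carrier (tensor R M N)"
  by (simp add: pure_tensor_def tensor_class_closed)

lemma tensor_class_Cons: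
  assumes "m \<in> carrier M" and "n \<in> carrier N" and "set xs \<subseteq> carrier M \<times> carrier N"
  shows "tensor_class R M N ((m, n) # xs) =
    pure_tensor R M N m n \<oplus>\<^bsub>tensor R M N\<^esub> tensor_class R M N xs"
  using tensor_add_class[of "[(m, n)]" xs] assms by (simp add: pure_tensor_def)

text \<open>
  The defining relations are symmetric in the two factors, so a statement about the first factor
  transfers to the second.
\<close>

lemma tensor_eq_swap:
  assumes "tensor_eq R M N xs ys"
  shows "tensor_eq R N M (map prod.swap xs) (map prod.swap ys)"
  using assms
proof induction
  case (refl xs)
  then show ?case by (intro tensor_eq.refl) auto
next
  case (comm xs ys)
  then show ?case by (simp only: map_append, intro tensor_eq.comm) auto
next
  case (smult d m n)
  then show ?case by (simp add: tensor_eq.sym[OF tensor_eq.smult])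
qed (auto intro: tensor_eq.intros)

end

section \<open>Linear maps out of tensor products\<close>

lemma linear_mapsD:
  assumes "f \<in> linear_maps R M N"
  shows "x \<in> carrier M \<Longrightarrow> f x \<in> carrier N"
    and "x \<in> carrier M \<Longrightarrow> y \<in> carrier M \<Longrightarrow> f (x \<oplus>\<^bsub>M\<^esub> y) = f x \<oplus>\<^bsub>N\<^esub> f y"
    and "c \<in> carrier R \<Longrightarrow> x \<in> carrier M \<Longrightarrow> f (c \<odot>\<^bsub>M\<^esub> x) = c \<odot>\<^bsub>N\<^esub> f x"
  using assms by (auto simp: linear_maps_def)

lemma linear_mapsI:
  assumes "\<And>x. x \<in> carrier M \<Longrightarrow> f x \<in> carrier N"
    and "\<And>x y. x \<in> carrier M \<Longrightarrow> y \<in> carrier M \<Longrightarrow> f (x \<oplus>\<^bsub>M\<^esub> y) = f x \<oplus>\<^bsub>N\<^esub> f y"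
    and "\<And>c x. c \<in> carrier R \<Longrightarrow> x \<in> carrier M \<Longrightarrow> f (c \<odot>\<^bsub>M\<^esub> x) = c \<odot>\<^bsub>N\<^esub> f x"
  shows "f \<in> linear_maps R M N"
  using assms by (auto simp: linear_maps_def)

lemma linear_maps_id: "(\<lambda>x. x) \<in> linear_maps R M M"
  by (auto simp: linear_maps_def)

lemma linear_maps_compose:
  assumes "f \<in> linear_maps R M N" and "g \<in> linear_maps R N L"
  shows "(\<lambda>x. g (f x)) \<in> linear_maps R M L"
  by (rule linear_mapsI) (simp_all add: linear_mapsD[OF assms(1)] linear_mapsD[OF assms(2)])

lemma linear_maps_zero:
  assumes "module R M" and "module R N" and f: "f \<in> linear_maps R M N"
  shows "f \<zero>\<^bsub>M\<^esub> = \<zero>\<^bsub>N\<^esub>"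
proof -
  interpret M: module R M by fact
  interpret N: module R N by fact
  have "f (\<zero>\<^bsub>R\<^esub> \<odot>\<^bsub>M\<^esub> \<zero>\<^bsub>M\<^esub>) = \<zero>\<^bsub>R\<^esub> \<odot>\<^bsub>N\<^esub> f \<zero>\<^bsub>M\<^esub>"
    by (rule linear_mapsD(3)[OF f]) auto
  then show ?thesis using linear_mapsD(1)[OF f] by simp
qed

locale bilinear_map = module_pair R M N + W: module R W
  for R :: "('r, 'x) ring_scheme" and M :: "('r, 'm, 'y) module_scheme"
    and N :: "('r, 'n, 'z) module_scheme" and W :: "('r, 'w, 'v) module_scheme" +
  fixes \<beta> :: "'m \<Rightarrow> 'n \<Rightarrow> 'w"
  assumes closed: "m \<in> carrier M \<Longrightarrow> n \<in> carrier N \<Longrightarrow> \<beta> m n \<in> carrier W"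
    and add_left: "m \<in> carrier M \<Longrightarrow> m' \<in> carrier M \<Longrightarrow> n \<in> carrier N \<Longrightarrow>
      \<beta> (m \<oplus>\<^bsub>M\<^esub> m') n = \<beta> m n \<oplus>\<^bsub>W\<^esub> \<beta> m' n"
    and add_right: "m \<in> carrier M \<Longrightarrow> n \<in> carrier N \<Longrightarrow> n' \<in> carrier N \<Longrightarrow>
      \<beta> m (n \<oplus>\<^bsub>N\<^esub> n') = \<beta> m n \<oplus>\<^bsub>W\<^esub> \<beta> m n'"
    and smult_left: "c \<in> carrier R \<Longrightarrow> m \<in> carrier M \<Longrightarrow> n \<in> carrier N \<Longrightarrow>
      \<beta> (c \<odot>\<^bsub>M\<^esub> m) n = c \<odot>\<^bsub>W\<^esub> \<beta> m n"
    and smult_right: "c \<in> carrier R \<Longrightarrow> m \<in> carrier M \<Longrightarrow> n \<in> carrier N \<Longrightarrow>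
      \<beta> m (c \<odot>\<^bsub>N\<^esub> n) = c \<odot>\<^bsub>W\<^esub> \<beta> m n"
begin

abbreviation eval_sum :: "('m \<times> 'n) list \<Rightarrow> 'w"
  where "eval_sum xs \<equiv> foldr (\<lambda>(m, n) w. \<beta> m n \<oplus>\<^bsub>W\<^esub> w) xs \<zero>\<^bsub>W\<^esub>"

lemma eval_sum_closed: "set xs \<subseteq> carrier M \<times> carrier N \<Longrightarrow> eval_sum xs \<in> carrier W"
  by (induction xs) (auto simp: closed)

lemma eval_sum_append:
  "set xs \<subseteq> carrier M \<times> carrier N \<Longrightarrow> set ys \<subseteq> carrier M \<times> carrier N \<Longrightarrow>
    eval_sum (xs @ ys) = eval_sum xs \<oplus>\<^bsub>W\<^esub> eval_sum ys"
  by (induction xs) (auto simp: closed eval_sum_closed W.a_assoc simp del: foldr_append)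

lemma zero_right:
  assumes "m \<in> carrier M" shows "\<beta> m \<zero>\<^bsub>N\<^esub> = \<zero>\<^bsub>W\<^esub>"
  using smult_right[of "\<zero>\<^bsub>R\<^esub>" m "\<zero>\<^bsub>N\<^esub>"] assms by (simp add: closed)

lemma eval_sum_cong:
  assumes "tensor_eq R M N xs ys"
  shows "eval_sum xs = eval_sum ys"
  using assms
proof induction
  case (append xs xs' ys ys')
  then have "set xs \<subseteq> carrier M \<times> carrier N" "set xs' \<subseteq> carrier M \<times> carrier N"
    "set ys \<subseteq> carrier M \<times> carrier N" "set ys' \<subseteq> carrier M \<times> carrier N"
    by (blast dest: tensor_eq_carrier)+
  then show ?case
    using append by (simp add: eval_sum_append del: foldr_append)
next
  case (comm xs ys)
  then show ?case
    by (simp add: eval_sum_append eval_sum_closed W.a_comm del: foldr_append)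
next
  case (smult c m n)
  then show ?case by (simp add: smult_left smult_right)
next
  case zero
  then show ?case by (simp add: closed zero_right)
next
  case left: (add_left m m' n)
  then show ?case by (simp add: left closed add_left W.a_assoc)
next
  case right: (add_right m n n')
  then show ?case by (simp add: right closed add_right W.a_assoc)
qed (simp_all only:)

text \<open>
  The value of the sum is constant on a class, which makes the choice in \<open>tensor_lift\<close> harmless.
\<close>

lemma lift_class:
  assumes "set xs \<subseteq> carrier M \<times> carrier N"
  shows "tensor_lift W \<beta> (tensor_class R M N xs) = eval_sum xs"
proof -
  have "eval_sum ys = eval_sum xs" if "ys \<in> tensor_class R M N xs" for ys
    using that by (metis eval_sum_cong tensor_class_memD)
  then have "eval_sum ` tensor_class R M N xs = (\<lambda>_. eval_sum xs) ` tensor_class R M N xs"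
    by (intro image_cong HOL.refl)
  also have "\<dots> = {eval_sum xs}"
    using tensor_class_self[OF assms] by (simp only: image_constant)
  finally have "eval_sum ` tensor_class R M N xs = {eval_sum xs}" .
  then show ?thesis by (simp add: tensor_lift_def)
qed

lemma lift_pure:
  "m \<in> carrier M \<Longrightarrow> n \<in> carrier N \<Longrightarrow> tensor_lift W \<beta> (pure_tensor R M N m n) = \<beta> m n"
  by (simp add: pure_tensor_def lift_class closed)

lemma lift_linear: "tensor_lift W \<beta> \<in> linear_maps R (tensor R M N) W"
proof (rule linear_mapsI)
  fix x assume "x \<in> carrier (tensor R M N)"
  then show "tensor_lift W \<beta> x \<in> carrier W"
    by (elim tensor_cases) (simp add: lift_class eval_sum_closed)
next
  fix x y assume "x \<in> carrier (tensor R M N)" "y \<in> carrier (tensor R M N)"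
  then show "tensor_lift W \<beta> (x \<oplus>\<^bsub>tensor R M N\<^esub> y) = tensor_lift W \<beta> x \<oplus>\<^bsub>W\<^esub> tensor_lift W \<beta> y"
    by (elim tensor_cases) (simp add: lift_class tensor_add_class eval_sum_append del: foldr_append)
next
  fix c x assume c: "c \<in> carrier R" and "x \<in> carrier (tensor R M N)"
  then obtain xs where xs: "set xs \<subseteq> carrier M \<times> carrier N" "x = tensor_class R M N xs"
    by (elim tensor_cases)
  have closed': "set (map (\<lambda>(m, n). (c \<odot>\<^bsub>M\<^esub> m, n)) xs) \<subseteq> carrier M \<times> carrier N"
    using xs(1) c by auto
  have "eval_sum (map (\<lambda>(m, n). (c \<odot>\<^bsub>M\<^esub> m, n)) xs) = c \<odot>\<^bsub>W\<^esub> eval_sum xs"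
    using xs(1)
  proof (induction xs)
    case Nil
    then show ?case using c by simp
  next
    case (Cons x xs)
    then show ?case
      using c by (auto simp: smult_left closed eval_sum_closed W.smult_r_distr split: prod.splits simp del: foldr_map)
  qed
  then show "tensor_lift W \<beta> (c \<odot>\<^bsub>tensor R M N\<^esub> x) = c \<odot>\<^bsub>W\<^esub> tensor_lift W \<beta> x"
    using xs c closed' by (simp add: lift_class tensor_smult_class del: foldr_map)
qed

end

context module_pair
begin

lemma linear_map_class:
  assumes W: "module R W" and f: "f \<in> linear_maps R (tensor R M N) W"
    and xs: "set xs \<subseteq> carrier M \<times> carrier N"
  shows "f (tensor_class R M N xs) =
    foldr (\<lambda>(m, n) w. f (pure_tensor R M N m n) \<oplus>\<^bsub>W\<^esub> w) xs \<zero>\<^bsub>W\<^esub>"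
  using xs
proof (induction xs)
  case Nil
  then show ?case
    using linear_maps_zero[OF tensor_module W f] by (simp add: zero_tensor)
next
  case (Cons x xs)
  then show ?case
    by (cases x) (simp add: tensor_class_Cons linear_mapsD[OF f] pure_tensor_closed tensor_class_closed)
qed

text \<open>
  Maps out of a tensor product are compared on pure tensors only, so that no representatives have to
  be chosen.
\<close>

lemma tensor_linear_ext:
  assumes W: "module R W" and "f \<in> linear_maps R (tensor R M N) W"
    and "g \<in> linear_maps R (tensor R M N) W"
    and eq: "\<And>m n. m \<in> carrier M \<Longrightarrow> n \<in> carrier N \<Longrightarrow>
      f (pure_tensor R M N m n) = g (pure_tensor R M N m n)"
    and "z \<in> carrier (tensor R M N)"
  shows "f z = g z"
proof -
  obtain xs where xs: "set xs \<subseteq> carrier M \<times> carrier N" "z = tensor_class R M N xs"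
    using assms(5) by (rule tensor_cases)
  have "foldr (\<lambda>(m, n) w. f (pure_tensor R M N m n) \<oplus>\<^bsub>W\<^esub> w) xs \<zero>\<^bsub>W\<^esub> =
      foldr (\<lambda>(m, n) w. g (pure_tensor R M N m n) \<oplus>\<^bsub>W\<^esub> w) xs \<zero>\<^bsub>W\<^esub>"
    using xs(1) by (intro foldr_cong HOL.refl) (auto simp: eq)
  then show ?thesis
    using xs linear_map_class[OF W assms(2)] linear_map_class[OF W assms(3)] by simp
qed

lemma pure_tensor_add_left:
  assumes "m \<in> carrier M" "m' \<in> carrier M" "n \<in> carrier N"
  shows "pure_tensor R M N (m \<oplus>\<^bsub>M\<^esub> m') n =
    pure_tensor R M N m n \<oplus>\<^bsub>tensor R M N\<^esub> pure_tensor R M N m' n"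
  using assms tensor_class_eqI[OF tensor_eq.add_left[of m M m' n N R]]
  by (simp add: pure_tensor_def tensor_add_class)

lemma pure_tensor_add_right:
  assumes "m \<in> carrier M" "n \<in> carrier N" "n' \<in> carrier N"
  shows "pure_tensor R M N m (n \<oplus>\<^bsub>N\<^esub> n') =
    pure_tensor R M N m n \<oplus>\<^bsub>tensor R M N\<^esub> pure_tensor R M N m n'"
  using assms tensor_class_eqI[OF tensor_eq.add_right[of m M n N n' R]]
  by (simp add: pure_tensor_def tensor_add_class)

lemma pure_tensor_smult_left:
  assumes "c \<in> carrier R" "m \<in> carrier M" "n \<in> carrier N"
  shows "pure_tensor R M N (c \<odot>\<^bsub>M\<^esub> m) n = c \<odot>\<^bsub>tensor R M N\<^esub> pure_tensor R M N m n"
  using assms by (simp add: pure_tensor_def tensor_smult_class)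

lemma pure_tensor_smult_right:
  assumes "c \<in> carrier R" "m \<in> carrier M" "n \<in> carrier N"
  shows "pure_tensor R M N m (c \<odot>\<^bsub>N\<^esub> n) = c \<odot>\<^bsub>tensor R M N\<^esub> pure_tensor R M N m n"
  using assms pure_tensor_smult_left[OF assms] tensor_class_eqI[OF tensor_eq.smult[OF assms]]
  by (simp add: pure_tensor_def)

lemma pure_tensor_bilinear: "bilinear_map R M N (tensor R M N) (pure_tensor R M N)"
proof -
  interpret T: module R "tensor R M N" by (rule tensor_module)
  show ?thesis
    by unfold_locales
      (auto simp: pure_tensor_closed pure_tensor_add_left pure_tensor_add_right
        pure_tensor_smult_left pure_tensor_smult_right)
qed

end

lemma bilinear_map_compose:
  assumes "bilinear_map R M N W \<beta>" and "module R M'" and "module R N'"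
    and f: "f \<in> linear_maps R M' M" and g: "g \<in> linear_maps R N' N"
  shows "bilinear_map R M' N' W (\<lambda>x y. \<beta> (f x) (g y))"
proof -
  interpret B: bilinear_map R M N W \<beta> by fact
  interpret M': module R M' by fact
  interpret N': module R N' by fact
  show ?thesis
    by unfold_locales
      (auto simp: linear_mapsD[OF f] linear_mapsD[OF g] B.closed B.add_left B.add_right
        B.smult_left B.smult_right)
qed

lemma tensor_map_bilinear:
  assumes "module R M" "module R N" "module R M'" "module R N'"
    and "f \<in> linear_maps R M' M" and "g \<in> linear_maps R N' N"
  shows "bilinear_map R M' N' (tensor R M N) (\<lambda>a b. pure_tensor R M N (f a) (g b))"
  by (rule bilinear_map_compose[OF module_pair.pure_tensor_bilinear[OF module_pair.intro]]) fact+

lemma tensor_map_linear: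
  assumes "module R M" "module R N" "module R M'" "module R N'"
    and "f \<in> linear_maps R M' M" and "g \<in> linear_maps R N' N"
  shows "tensor_map R M N f g \<in> linear_maps R (tensor R M' N') (tensor R M N)"
  unfolding tensor_map_def by (rule bilinear_map.lift_linear[OF tensor_map_bilinear[OF assms]])

lemma tensor_map_pure:
  assumes "module R M" "module R N" "module R M'" "module R N'"
    and "f \<in> linear_maps R M' M" and "g \<in> linear_maps R N' N"
    and "a \<in> carrier M'" and "b \<in> carrier N'"
  shows "tensor_map R M N f g (pure_tensor R M' N' a b) = pure_tensor R M N (f a) (g b)"
  unfolding tensor_map_def
  using assms(7,8) by (rule bilinear_map.lift_pure[OF tensor_map_bilinear[OF assms(1-6)]])

lemma tensor_map_class:
  assumes mods: "module R M" "module R N" "module R M'" "module R N'"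
    and f: "f \<in> linear_maps R M' M" and g: "g \<in> linear_maps R N' N"
    and xs: "set xs \<subseteq> carrier M' \<times> carrier N'"
  shows "tensor_map R M N f g (tensor_class R M' N' xs) =
    tensor_class R M N (map (\<lambda>(a, b). (f a, g b)) xs)"
proof -
  interpret B: bilinear_map R M' N' "tensor R M N" "\<lambda>a b. pure_tensor R M N (f a) (g b)"
    by (rule tensor_map_bilinear[OF mods f g])
  interpret MN: module_pair R M N using mods by (intro module_pair.intro)
  have "B.eval_sum xs = tensor_class R M N (map (\<lambda>(a, b). (f a, g b)) xs)"
    using xs
  proof (induction xs)
    case Nil
    then show ?case by (simp add: MN.zero_tensor)
  next
    case (Cons x xs)
    then have "set (map (\<lambda>(a, b). (f a, g b)) xs) \<subseteq> carrier M \<times> carrier N"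
      by (auto simp: linear_mapsD[OF f] linear_mapsD[OF g])
    with Cons show ?case
      by (cases x) (simp add: MN.tensor_class_Cons linear_mapsD[OF f] linear_mapsD[OF g])
  qed
  then show ?thesis by (simp add: tensor_map_def B.lift_class[OF xs])
qed

text \<open>
  The associativity map is a bilinear map in \<open>(X, n)\<close> that is itself obtained, for fixed \<open>n\<close>, by
  lifting a bilinear map.  Its additivity in \<open>n\<close> is an identity between linear maps of \<open>X\<close>, hence
  it suffices to see it on pure tensors.
\<close>

lemma tensor_assoc_linear_pure:
  assumes mods: "module R L" "module R M" "module R N"
  shows "tensor_assoc R L M N \<in>
      linear_maps R (tensor R (tensor R L M) N) (tensor R L (tensor R M N))" (is ?linear)
    and "\<lbrakk>l \<in> carrier L; m \<in> carrier M; n \<in> carrier N\<rbrakk> \<Longrightarrow>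
      tensor_assoc R L M N (pure_tensor R (tensor R L M) N (pure_tensor R L M l m) n) =
      pure_tensor R L (tensor R M N) l (pure_tensor R M N m n)" (is "_ \<Longrightarrow> _ \<Longrightarrow> _ \<Longrightarrow> ?pure")
proof -
  interpret LM: module_pair R L M using mods by (intro module_pair.intro)
  interpret MN: module_pair R M N using mods by (intro module_pair.intro)
  interpret LMm: module R "tensor R L M" by (rule LM.tensor_module)
  interpret MNm: module R "tensor R M N" by (rule MN.tensor_module)
  interpret LMN: module_pair R L "tensor R M N" ..
  interpret T: module R "tensor R L (tensor R M N)" by (rule LMN.tensor_module)
  define \<gamma> where "\<gamma> n = (\<lambda>l m. pure_tensor R L (tensor R M N) l (pure_tensor R M N m n))" for n
  define T where "T = tensor R L (tensor R M N)"
  have \<gamma>: "bilinear_map R L M T (\<gamma> n)" if "n \<in> carrier N" for n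
    using that unfolding \<gamma>_def T_def
    by unfold_locales
      (auto simp: LMN.pure_tensor_closed LMN.pure_tensor_add_left LMN.pure_tensor_add_right
        LMN.pure_tensor_smult_left LMN.pure_tensor_smult_right MN.pure_tensor_closed
        MN.pure_tensor_add_left MN.pure_tensor_smult_left)
  define \<delta> where "\<delta> n = tensor_lift T (\<gamma> n)" for n
  have \<delta>: "\<delta> n \<in> linear_maps R (tensor R L M) T" if "n \<in> carrier N" for n
    unfolding \<delta>_def using bilinear_map.lift_linear[OF \<gamma>[OF that]] .
  have \<delta>_pure: "\<delta> n (pure_tensor R L M l m) = \<gamma> n l m"
    if "n \<in> carrier N" "l \<in> carrier L" "m \<in> carrier M" for n l m
    unfolding \<delta>_def using bilinear_map.lift_pure[OF \<gamma>[OF that(1)] that(2,3)] .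
  have T_module: "module R T" unfolding T_def by (rule LMN.tensor_module)
  interpret T': module R T by fact
  have \<delta>_add: "\<delta> (n \<oplus>\<^bsub>N\<^esub> n') X = \<delta> n X \<oplus>\<^bsub>T\<^esub> \<delta> n' X"
    if "n \<in> carrier N" "n' \<in> carrier N" "X \<in> carrier (tensor R L M)" for n n' X
  proof (rule LM.tensor_linear_ext[OF T_module \<delta> _ _ that(3)])
    show "(\<lambda>X. \<delta> n X \<oplus>\<^bsub>T\<^esub> \<delta> n' X) \<in> linear_maps R (tensor R L M) T"
      by (rule linear_mapsI)
        (simp_all add: linear_mapsD[OF \<delta>] that T'.smult_r_distr T'.a_ac)
  qed (use that in \<open>simp_all add: \<delta>_pure \<gamma>_def T_def MN.pure_tensor_add_right
        MN.pure_tensor_closed LMN.pure_tensor_add_right\<close>)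
  have \<delta>_smult: "\<delta> (c \<odot>\<^bsub>N\<^esub> n) X = c \<odot>\<^bsub>T\<^esub> \<delta> n X"
    if "n \<in> carrier N" "c \<in> carrier R" "X \<in> carrier (tensor R L M)" for n c X
  proof (rule LM.tensor_linear_ext[OF T_module \<delta> _ _ that(3)])
    have "c \<odot>\<^bsub>T\<^esub> (d \<odot>\<^bsub>T\<^esub> x) = d \<odot>\<^bsub>T\<^esub> (c \<odot>\<^bsub>T\<^esub> x)" if "d \<in> carrier R" "x \<in> carrier T" for d x
      using that \<open>c \<in> carrier R\<close> by (intro T'.smult_commute)
    then show "(\<lambda>X. c \<odot>\<^bsub>T\<^esub> \<delta> n X) \<in> linear_maps R (tensor R L M) T"
      using that by (intro linear_mapsI) (simp_all add: linear_mapsD[OF \<delta>] T'.smult_r_distr)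
  qed (use that in \<open>simp_all add: \<delta>_pure \<gamma>_def T_def MN.pure_tensor_smult_right
        MN.pure_tensor_closed LMN.pure_tensor_smult_right\<close>)
  interpret B: bilinear_map R "tensor R L M" N T "\<lambda>X n. \<delta> n X"
    by unfold_locales (auto simp: linear_mapsD[OF \<delta>] \<delta>_add \<delta>_smult)
  have assoc: "tensor_assoc R L M N = tensor_lift T (\<lambda>X n. \<delta> n X)"
    unfolding tensor_assoc_def \<delta>_def \<gamma>_def T_def Let_def ..
  show ?linear
    using B.lift_linear by (simp add: assoc T_def)
  show ?pure if "l \<in> carrier L" "m \<in> carrier M" "n \<in> carrier N"
    using that B.lift_pure[of "pure_tensor R L M l m" n]
    by (simp add: assoc \<delta>_pure \<gamma>_def LM.pure_tensor_closed)
qed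

lemma self_algebra_simps [simp]:
  "carrier (self_algebra R) = carrier R" "add (self_algebra R) = add R"
  "smult (self_algebra R) = monoid.mult R" "zero (self_algebra R) = zero R"
  by (simp_all add: self_algebra_def)

context module_pair
begin

text \<open>
  The contractions \<open>f \<otimes> id\<close> and \<open>id \<otimes> f\<close> by a linear functional \<open>f\<close>, with values in the remaining
  factor.  They read off the coefficients of a tensor.
\<close>

abbreviation slice_left :: "('m \<Rightarrow> 'r) \<Rightarrow> ('m \<times> 'n) list set \<Rightarrow> 'n"
  where "slice_left f \<equiv> tensor_lift N (\<lambda>m n. f m \<odot>\<^bsub>N\<^esub> n)"

abbreviation slice_right :: "('n \<Rightarrow> 'r) \<Rightarrow> ('m \<times> 'n) list set \<Rightarrow> 'm"
  where "slice_right f \<equiv> tensor_lift M (\<lambda>m n. f n \<odot>\<^bsub>M\<^esub> m)"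

lemma slice_left_bilinear:
  assumes "f \<in> linear_maps R M (self_algebra R)"
  shows "bilinear_map R M N N (\<lambda>m n. f m \<odot>\<^bsub>N\<^esub> n)"
proof unfold_locales
  fix c m n assume c: "c \<in> carrier R" "m \<in> carrier M" "n \<in> carrier N"
  have f: "f m \<in> carrier R" using linear_mapsD(1)[OF assms c(2)] by simp
  then show "f m \<odot>\<^bsub>N\<^esub> (c \<odot>\<^bsub>N\<^esub> n) = c \<odot>\<^bsub>N\<^esub> (f m \<odot>\<^bsub>N\<^esub> n)"
    using c by (intro N.smult_commute)
  show "f (c \<odot>\<^bsub>M\<^esub> m) \<odot>\<^bsub>N\<^esub> n = c \<odot>\<^bsub>N\<^esub> (f m \<odot>\<^bsub>N\<^esub> n)"
    using c f linear_mapsD(3)[OF assms] by (simp add: N.smult_assoc1)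
qed (use linear_mapsD(1,2)[OF assms] in \<open>auto simp: N.smult_l_distr N.smult_r_distr\<close>)

lemma slice_right_bilinear:
  assumes "f \<in> linear_maps R N (self_algebra R)"
  shows "bilinear_map R M N M (\<lambda>m n. f n \<odot>\<^bsub>M\<^esub> m)"
proof unfold_locales
  fix c m n assume c: "c \<in> carrier R" "m \<in> carrier M" "n \<in> carrier N"
  have f: "f n \<in> carrier R" using linear_mapsD(1)[OF assms c(3)] by simp
  then show "f n \<odot>\<^bsub>M\<^esub> (c \<odot>\<^bsub>M\<^esub> m) = c \<odot>\<^bsub>M\<^esub> (f n \<odot>\<^bsub>M\<^esub> m)"
    using c by (intro M.smult_commute)
  show "f (c \<odot>\<^bsub>N\<^esub> n) \<odot>\<^bsub>M\<^esub> m = c \<odot>\<^bsub>M\<^esub> (f n \<odot>\<^bsub>M\<^esub> m)"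
    using c f linear_mapsD(3)[OF assms] by (simp add: M.smult_assoc1)
qed (use linear_mapsD(1,2)[OF assms] in \<open>auto simp: M.smult_l_distr M.smult_r_distr\<close>)

end

text \<open>
  Both sides are linear in \<open>z\<close> and agree on \<open>(m \<otimes> a) \<otimes> b\<close>.  This turns coassociativity into an
  identity between contractions.
\<close>

lemma slice_right_assoc:
  assumes mods: "module R M" "module R A" "module R B"
    and f: "f \<in> linear_maps R B (self_algebra R)"
    and z: "z \<in> carrier (tensor R (tensor R M A) B)"
  shows "tensor_map R M A (\<lambda>x. x) (tensor_lift A (\<lambda>x y. f y \<odot>\<^bsub>A\<^esub> x)) (tensor_assoc R M A B z) =
    tensor_lift (tensor R M A) (\<lambda>X y. f y \<odot>\<^bsub>tensor R M A\<^esub> X) z"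
proof -
  interpret MA: module_pair R M A using mods by (intro module_pair.intro)
  interpret AB: module_pair R A B using mods by (intro module_pair.intro)
  interpret MAm: module R "tensor R M A" by (rule MA.tensor_module)
  interpret ABm: module R "tensor R A B" by (rule AB.tensor_module)
  interpret MAB: module_pair R "tensor R M A" B ..
  interpret S: bilinear_map R A B A "\<lambda>x y. f y \<odot>\<^bsub>A\<^esub> x" by (rule AB.slice_right_bilinear[OF f])
  interpret S': bilinear_map R "tensor R M A" B "tensor R M A" "\<lambda>X y. f y \<odot>\<^bsub>tensor R M A\<^esub> X"
    by (rule MAB.slice_right_bilinear[OF f])
  let ?h = "tensor_map R M A (\<lambda>x. x) (AB.slice_right f)"
  note h_mods = mods(1,2,1) AB.tensor_module linear_maps_id S.lift_linear
  have h: "?h \<in> linear_maps R (tensor R M (tensor R A B)) (tensor R M A)"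
    by (rule tensor_map_linear[OF h_mods])
  have assoc: "tensor_assoc R M A B \<in>
      linear_maps R (tensor R (tensor R M A) B) (tensor R M (tensor R A B))"
    by (rule tensor_assoc_linear_pure(1)[OF mods])
  show ?thesis
  proof (rule MAB.tensor_linear_ext[OF MA.tensor_module linear_maps_compose[OF assoc h] S'.lift_linear _ z])
    fix X b assume X: "X \<in> carrier (tensor R M A)" and b: "b \<in> carrier B"
    have fb: "f b \<in> carrier R" using linear_mapsD(1)[OF f b] by simp
    interpret P: bilinear_map R "tensor R M A" B "tensor R (tensor R M A) B"
      "pure_tensor R (tensor R M A) B" by (rule MAB.pure_tensor_bilinear)
    have pure_b: "(\<lambda>X. pure_tensor R (tensor R M A) B X b) \<in>
        linear_maps R (tensor R M A) (tensor R (tensor R M A) B)"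
      using b by (intro linear_mapsI) (simp_all add: P.closed P.add_left P.smult_left)
    have "?h (tensor_assoc R M A B (pure_tensor R (tensor R M A) B X b)) = f b \<odot>\<^bsub>tensor R M A\<^esub> X"
    proof (rule MA.tensor_linear_ext[OF MA.tensor_module
          linear_maps_compose[OF pure_b linear_maps_compose[OF assoc h]] _ _ X])
      have "f b \<odot>\<^bsub>tensor R M A\<^esub> (c \<odot>\<^bsub>tensor R M A\<^esub> x) = c \<odot>\<^bsub>tensor R M A\<^esub> (f b \<odot>\<^bsub>tensor R M A\<^esub> x)"
        if "c \<in> carrier R" "x \<in> carrier (tensor R M A)" for c x
        using that fb by (intro MAm.smult_commute)
      then show "(\<lambda>X. f b \<odot>\<^bsub>tensor R M A\<^esub> X) \<in> linear_maps R (tensor R M A) (tensor R M A)"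
        using fb by (intro linear_mapsI) (simp_all add: MAm.smult_r_distr)
    next
      fix m a assume ma: "m \<in> carrier M" "a \<in> carrier A"
      then show "?h (tensor_assoc R M A B
          (pure_tensor R (tensor R M A) B (pure_tensor R M A m a) b)) =
          f b \<odot>\<^bsub>tensor R M A\<^esub> pure_tensor R M A m a"
        using b fb
        by (simp add: tensor_assoc_linear_pure(2)[OF mods] tensor_map_pure[OF h_mods]
            AB.pure_tensor_closed S.lift_pure MA.pure_tensor_smult_right)
    qed
    then show "?h (tensor_assoc R M A B (pure_tensor R (tensor R M A) B X b)) =
        MAB.slice_right f (pure_tensor R (tensor R M A) B X b)"
      using X b by (simp add: S'.lift_pure)
  qed
qed

section \<open>Linear algebra over a field\<close>

lemma (in module) submoduleI_smult:
  assumes "H \<subseteq> carrier M" and "\<zero>\<^bsub>M\<^esub> \<in> H"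
    and "\<And>a b. a \<in> H \<Longrightarrow> b \<in> H \<Longrightarrow> a \<oplus>\<^bsub>M\<^esub> b \<in> H"
    and "\<And>a x. a \<in> carrier R \<Longrightarrow> x \<in> H \<Longrightarrow> a \<odot>\<^bsub>M\<^esub> x \<in> H"
  shows "submodule H R M"
proof (rule submoduleI)
  fix a assume a: "a \<in> H"
  then have "\<ominus>\<^bsub>M\<^esub> a = (\<ominus>\<^bsub>R\<^esub> \<one>\<^bsub>R\<^esub>) \<odot>\<^bsub>M\<^esub> a"
    using assms(1) by (subst smult_l_minus) auto
  then show "\<ominus>\<^bsub>M\<^esub> a \<in> H" using a assms(4) by simp
qed (use assms in auto)

lemma (in module) submodule_zero_closed: "submodule V R M \<Longrightarrow> \<zero>\<^bsub>M\<^esub> \<in> V"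
  using submodule.axioms(1) subgroup.one_closed by fastforce

lemma (in module) submodule_sum:
  assumes V: "submodule V R M" and W: "submodule W R M"
  shows "submodule {v \<oplus>\<^bsub>M\<^esub> w | v w. v \<in> V \<and> w \<in> W} R M" (is "submodule ?S R M")
    and "V \<subseteq> {v \<oplus>\<^bsub>M\<^esub> w | v w. v \<in> V \<and> w \<in> W}"
    and "W \<subseteq> {v \<oplus>\<^bsub>M\<^esub> w | v w. v \<in> V \<and> w \<in> W}"
proof -
  note VE = submoduleE[OF V] and WE = submoduleE[OF W]
  note zero = submodule_zero_closed[OF V] submodule_zero_closed[OF W]
  show "submodule ?S R M"
  proof (rule submoduleI_smult)
    show "?S \<subseteq> carrier M" using VE(1) WE(1) by auto
    have "\<zero>\<^bsub>M\<^esub> \<oplus>\<^bsub>M\<^esub> \<zero>\<^bsub>M\<^esub> \<in> ?S" using zero by blast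
    then show "\<zero>\<^bsub>M\<^esub> \<in> ?S" by simp
  next
    fix a b assume "a \<in> ?S" "b \<in> ?S"
    then obtain v w v' w' where *: "a = v \<oplus>\<^bsub>M\<^esub> w" "b = v' \<oplus>\<^bsub>M\<^esub> w'"
        "v \<in> V" "w \<in> W" "v' \<in> V" "w' \<in> W" by blast
    then have "v \<in> carrier M" "w \<in> carrier M" "v' \<in> carrier M" "w' \<in> carrier M"
      using VE(1) WE(1) by auto
    then have "a \<oplus>\<^bsub>M\<^esub> b = (v \<oplus>\<^bsub>M\<^esub> v') \<oplus>\<^bsub>M\<^esub> (w \<oplus>\<^bsub>M\<^esub> w')" using * by (simp add: M.a_ac)
    then show "a \<oplus>\<^bsub>M\<^esub> b \<in> ?S" using * VE(5) WE(5) by blast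
  next
    fix c x assume c: "c \<in> carrier R" and "x \<in> ?S"
    then obtain v w where *: "x = v \<oplus>\<^bsub>M\<^esub> w" "v \<in> V" "w \<in> W" by blast
    then have "c \<odot>\<^bsub>M\<^esub> x = (c \<odot>\<^bsub>M\<^esub> v) \<oplus>\<^bsub>M\<^esub> (c \<odot>\<^bsub>M\<^esub> w)"
      using VE(1) WE(1) c by (auto intro: smult_r_distr)
    then show "c \<odot>\<^bsub>M\<^esub> x \<in> ?S" using * c VE(4) WE(4) by blast
  qed
  show "V \<subseteq> ?S"
  proof
    fix v assume v: "v \<in> V"
    then have "v = v \<oplus>\<^bsub>M\<^esub> \<zero>\<^bsub>M\<^esub>" using VE(1) by auto
    then show "v \<in> ?S" using v zero by blast
  qed
  show "W \<subseteq> ?S"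
  proof
    fix w assume w: "w \<in> W"
    then have "w = \<zero>\<^bsub>M\<^esub> \<oplus>\<^bsub>M\<^esub> w" using WE(1) by auto
    then show "w \<in> ?S" using w zero by blast
  qed
qed

text \<open>
  The span of a list, presented as an iterated sum of cyclic submodules, so that an element of the
  span of a nonempty list splits off a multiple of the head.
\<close>

primrec lin_span :: "('r, 'x) ring_scheme \<Rightarrow> ('r, 'm, 'y) module_scheme \<Rightarrow> 'm list \<Rightarrow> 'm set"
  where "lin_span R M [] = {\<zero>\<^bsub>M\<^esub>}"
  | "lin_span R M (x # xs) =
      {y \<oplus>\<^bsub>M\<^esub> s | y s. y \<in> {c \<odot>\<^bsub>M\<^esub> x | c. c \<in> carrier R} \<and> s \<in> lin_span R M xs}"

lemma (in module) submodule_multiples: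
  assumes x: "x \<in> carrier M"
  shows "submodule {c \<odot>\<^bsub>M\<^esub> x | c. c \<in> carrier R} R M" (is "submodule ?S R M")
proof (rule submoduleI_smult)
  show "?S \<subseteq> carrier M" using x by auto
  have "\<zero>\<^bsub>R\<^esub> \<odot>\<^bsub>M\<^esub> x \<in> ?S" by blast
  then show "\<zero>\<^bsub>M\<^esub> \<in> ?S" using x by simp
next
  fix a b assume "a \<in> ?S" "b \<in> ?S"
  then obtain c d where "c \<in> carrier R" "d \<in> carrier R" "a = c \<odot>\<^bsub>M\<^esub> x" "b = d \<odot>\<^bsub>M\<^esub> x" by blast
  moreover from this have "a \<oplus>\<^bsub>M\<^esub> b = (c \<oplus>\<^bsub>R\<^esub> d) \<odot>\<^bsub>M\<^esub> x"
    using x by (simp add: smult_l_distr)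
  ultimately show "a \<oplus>\<^bsub>M\<^esub> b \<in> ?S" by blast
next
  fix a y assume "a \<in> carrier R" "y \<in> ?S"
  then obtain c where "c \<in> carrier R" "y = c \<odot>\<^bsub>M\<^esub> x" by blast
  moreover from this have "a \<odot>\<^bsub>M\<^esub> y = (a \<otimes>\<^bsub>R\<^esub> c) \<odot>\<^bsub>M\<^esub> x"
    using x \<open>a \<in> carrier R\<close> by (simp add: smult_assoc1)
  ultimately show "a \<odot>\<^bsub>M\<^esub> y \<in> ?S" using \<open>a \<in> carrier R\<close> by blast
qed

context module
begin

lemma lin_span_submodule: "set xs \<subseteq> carrier M \<Longrightarrow> submodule (lin_span R M xs) R M"
proof (induction xs)
  case Nil
  show ?case by (rule submoduleI_smult) auto
next
  case (Cons x xs)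
  then show ?case
    by (simp only: lin_span.simps) (intro submodule_sum(1) submodule_multiples, auto)
qed

lemma lin_span_superset: "set xs \<subseteq> carrier M \<Longrightarrow> set xs \<subseteq> lin_span R M xs"
proof (induction xs)
  case (Cons x xs)
  let ?L = "{c \<odot>\<^bsub>M\<^esub> x | c. c \<in> carrier R}"
  have mods: "submodule ?L R M" "submodule (lin_span R M xs) R M"
    using Cons.prems by (simp_all add: submodule_multiples lin_span_submodule)
  have "x = \<one>\<^bsub>R\<^esub> \<odot>\<^bsub>M\<^esub> x" using Cons.prems by simp
  then have "x \<in> ?L" by blast
  then show ?case
    using Cons submodule_sum(2,3)[OF mods] by (simp only: lin_span.simps list.set) auto
qed simp

lemma lin_span_least:
  assumes "submodule V R M" and "set xs \<subseteq> V"
  shows "lin_span R M xs \<subseteq> V"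
  using assms(2)
proof (induction xs)
  case Nil
  then show ?case using submodule_zero_closed[OF assms(1)] by simp
next
  case (Cons x xs)
  then show ?case using submoduleE(4,5)[OF assms(1)] by auto
qed

text \<open>
  A functional that separates a point from a subspace, without a choice of basis: a subspace \<open>W\<close> that
  contains \<open>V\<close> and is maximal among those avoiding \<open>a\<close> is a complement of the line spanned by \<open>a\<close>,
  since adjoining any further vector brings in \<open>a\<close>.  The functional is the coordinate along \<open>a\<close>.
\<close>

lemma separating_functional:
  assumes "field R" and V: "submodule V R M" and a: "a \<in> carrier M" "a \<notin> V"
  obtains f where "f \<in> linear_maps R M (self_algebra R)" and "f a = \<one>\<^bsub>R\<^esub>" and "\<And>v. v \<in> V \<Longrightarrow> f v = \<zero>\<^bsub>R\<^esub>"
proof -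
  interpret F: field R by fact
  \<comment> \<open>Subspaces between \<open>V\<close> and the complement of \<open>{a}\<close>; unions of chains stay in this family.\<close>
  define \<A> where "\<A> = {W. submodule W R M \<and> V \<subseteq> W \<and> a \<notin> W}"
  have "\<exists>W\<in>\<A>. \<forall>X\<in>\<A>. W \<subseteq> X \<longrightarrow> X = W"
  proof (rule subset_Zorn_nonempty)
    show "\<A> \<noteq> {}" using V a by (auto simp: \<A>_def)
  next
    fix \<C> assume ne: "\<C> \<noteq> {}" and chain: "subset.chain \<A> \<C>"
    have sub: "submodule W R M" "V \<subseteq> W" "a \<notin> W" if "W \<in> \<C>" for W
      using chain that by (auto simp: subset.chain_def \<A>_def)
    have "submodule (\<Union>\<C>) R M"
    proof (rule submoduleI_smult)
      show "\<Union>\<C> \<subseteq> carrier M" using sub(1) submoduleE(1) by blast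
      show "\<zero>\<^bsub>M\<^esub> \<in> \<Union>\<C>" using ne sub(1) submodule_zero_closed by blast
    next
      fix x y assume "x \<in> \<Union>\<C>" "y \<in> \<Union>\<C>"
      then obtain W where "W \<in> \<C>" "x \<in> W" "y \<in> W"
        using chain by (auto simp: subset_chain_def) (metis subsetD)
      then show "x \<oplus>\<^bsub>M\<^esub> y \<in> \<Union>\<C>" using sub(1) submoduleE(5) by blast
    next
      fix c x assume "c \<in> carrier R" "x \<in> \<Union>\<C>"
      then show "c \<odot>\<^bsub>M\<^esub> x \<in> \<Union>\<C>" using sub(1) submoduleE(4) by blast
    qed
    then show "\<Union>\<C> \<in> \<A>" using ne sub(2,3) by (auto simp: \<A>_def)
  qed
  then obtain W where W: "submodule W R M" "V \<subseteq> W" "a \<notin> W"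
    and max: "\<And>X. submodule X R M \<Longrightarrow> W \<subseteq> X \<Longrightarrow> a \<notin> X \<Longrightarrow> X = W"
    by (auto simp: \<A>_def)
  note WE = submoduleE[OF W(1)]
  \<comment> \<open>Maximality of \<open>W\<close>: a vector outside \<open>W\<close> generates \<open>a\<close> together with \<open>W\<close>.\<close>
  have decomp: "\<exists>c\<in>carrier R. \<exists>w\<in>W. x = c \<odot>\<^bsub>M\<^esub> a \<oplus>\<^bsub>M\<^esub> w" if x: "x \<in> carrier M" for x
  proof (cases "x \<in> W")
    case True
    then have "x = \<zero>\<^bsub>R\<^esub> \<odot>\<^bsub>M\<^esub> a \<oplus>\<^bsub>M\<^esub> x" using x a by simp
    with True show ?thesis by blast
  next
    case False
    let ?L = "{c \<odot>\<^bsub>M\<^esub> x | c. c \<in> carrier R}"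
    let ?X = "{v \<oplus>\<^bsub>M\<^esub> w | v w. v \<in> ?L \<and> w \<in> W}"
    note L = submodule_multiples[OF x]
    have "x = \<one>\<^bsub>R\<^esub> \<odot>\<^bsub>M\<^esub> x" using x by simp
    then have "x \<in> ?X" using submodule_sum(2)[OF L W(1)] by blast
    then have "?X \<noteq> W" using False by blast
    then have "a \<in> ?X" using max submodule_sum[OF L W(1)] by blast
    then obtain c w where cw: "c \<in> carrier R" "w \<in> W" "a = c \<odot>\<^bsub>M\<^esub> x \<oplus>\<^bsub>M\<^esub> w" by blast
    have w: "w \<in> carrier M" using cw WE(1) by blast
    have "c \<noteq> \<zero>\<^bsub>R\<^esub>" using cw W(3) x w by auto
    then have c: "inv\<^bsub>R\<^esub> c \<in> carrier R" "inv\<^bsub>R\<^esub> c \<otimes>\<^bsub>R\<^esub> c = \<one>\<^bsub>R\<^esub>"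
      using cw(1) F.field_Units R.Units_l_inv by auto
    have "inv\<^bsub>R\<^esub> c \<odot>\<^bsub>M\<^esub> a = x \<oplus>\<^bsub>M\<^esub> inv\<^bsub>R\<^esub> c \<odot>\<^bsub>M\<^esub> w"
      using cw c w x by (simp add: smult_r_distr flip: smult_assoc1)
    then have "x = inv\<^bsub>R\<^esub> c \<odot>\<^bsub>M\<^esub> a \<oplus>\<^bsub>M\<^esub> (\<ominus>\<^bsub>M\<^esub> (inv\<^bsub>R\<^esub> c \<odot>\<^bsub>M\<^esub> w))"
      using c w x by (simp add: M.a_assoc M.r_neg)
    moreover have "\<ominus>\<^bsub>M\<^esub> (inv\<^bsub>R\<^esub> c \<odot>\<^bsub>M\<^esub> w) \<in> W" using WE(3,4) c cw by blast
    ultimately show ?thesis using c by blast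
  qed
  \<comment> \<open>Two decompositions with different coefficients would put a nonzero multiple of \<open>a\<close> into \<open>W\<close>.\<close>
  have unique: "c = d"
    if "c \<in> carrier R" "d \<in> carrier R" "v \<in> W" "w \<in> W"
      "c \<odot>\<^bsub>M\<^esub> a \<oplus>\<^bsub>M\<^esub> v = d \<odot>\<^bsub>M\<^esub> a \<oplus>\<^bsub>M\<^esub> w" for c d v w
  proof (rule ccontr)
    assume "c \<noteq> d"
    have vw: "v \<in> carrier M" "w \<in> carrier M" using that WE(1) by auto
    let ?e = "c \<ominus>\<^bsub>R\<^esub> d"
    have e: "?e \<in> carrier R" using that by simp
    have "?e \<noteq> \<zero>\<^bsub>R\<^esub>" using \<open>c \<noteq> d\<close> that R.r_right_minus_eq by blast
    then have inv: "inv\<^bsub>R\<^esub> ?e \<in> carrier R" "inv\<^bsub>R\<^esub> ?e \<otimes>\<^bsub>R\<^esub> ?e = \<one>\<^bsub>R\<^esub>"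
      using e F.field_Units R.Units_l_inv by auto
    have "?e \<odot>\<^bsub>M\<^esub> a = c \<odot>\<^bsub>M\<^esub> a \<oplus>\<^bsub>M\<^esub> (\<ominus>\<^bsub>M\<^esub> (d \<odot>\<^bsub>M\<^esub> a))"
      using that a by (simp add: R.minus_eq smult_l_distr smult_l_minus)
    also have "c \<odot>\<^bsub>M\<^esub> a = (d \<odot>\<^bsub>M\<^esub> a \<oplus>\<^bsub>M\<^esub> w) \<oplus>\<^bsub>M\<^esub> (\<ominus>\<^bsub>M\<^esub> v)"
      using that(1,2) vw a that(5)[symmetric] by (simp add: M.a_assoc M.r_neg)
    also have "(d \<odot>\<^bsub>M\<^esub> a \<oplus>\<^bsub>M\<^esub> w) \<oplus>\<^bsub>M\<^esub> (\<ominus>\<^bsub>M\<^esub> v) \<oplus>\<^bsub>M\<^esub> (\<ominus>\<^bsub>M\<^esub> (d \<odot>\<^bsub>M\<^esub> a)) = w \<oplus>\<^bsub>M\<^esub> (\<ominus>\<^bsub>M\<^esub> v)"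
      using that(1,2) vw a by (simp add: M.a_ac M.r_neg M.r_neg2 M.r_neg1)
    finally have "?e \<odot>\<^bsub>M\<^esub> a \<in> W" using that WE(3,5) by simp
    then have "inv\<^bsub>R\<^esub> ?e \<odot>\<^bsub>M\<^esub> (?e \<odot>\<^bsub>M\<^esub> a) \<in> W" using WE(4) inv by blast
    then show False using W(3) a e inv by (simp flip: smult_assoc1)
  qed
  define f where "f x = (THE c. c \<in> carrier R \<and> (\<exists>w\<in>W. x = c \<odot>\<^bsub>M\<^esub> a \<oplus>\<^bsub>M\<^esub> w))" for x
  have f_eq: "f (c \<odot>\<^bsub>M\<^esub> a \<oplus>\<^bsub>M\<^esub> w) = c" if "c \<in> carrier R" "w \<in> W" for c w
    unfolding f_def using that unique by (intro the_equality) blast+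
  show thesis
  proof (rule that[of f])
    show "f \<in> linear_maps R M (self_algebra R)"
    proof (rule linear_mapsI)
      fix x assume "x \<in> carrier M"
      then show "f x \<in> carrier (self_algebra R)" using decomp f_eq by fastforce
    next
      fix x y assume "x \<in> carrier M" "y \<in> carrier M"
      then obtain c d v w where *: "c \<in> carrier R" "d \<in> carrier R" "v \<in> W" "w \<in> W"
          "x = c \<odot>\<^bsub>M\<^esub> a \<oplus>\<^bsub>M\<^esub> v" "y = d \<odot>\<^bsub>M\<^esub> a \<oplus>\<^bsub>M\<^esub> w"
        using decomp by metis
      have vw: "v \<in> carrier M" "w \<in> carrier M" using * WE(1) by auto
      have "x \<oplus>\<^bsub>M\<^esub> y = (c \<oplus>\<^bsub>R\<^esub> d) \<odot>\<^bsub>M\<^esub> a \<oplus>\<^bsub>M\<^esub> (v \<oplus>\<^bsub>M\<^esub> w)"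
        using * vw a by (simp add: smult_l_distr M.a_ac)
      then have "f (x \<oplus>\<^bsub>M\<^esub> y) = c \<oplus>\<^bsub>R\<^esub> d" using * WE(5) by (simp add: f_eq)
      then show "f (x \<oplus>\<^bsub>M\<^esub> y) = f x \<oplus>\<^bsub>self_algebra R\<^esub> f y" using * by (simp add: f_eq)
    next
      fix d x assume d: "d \<in> carrier R" and "x \<in> carrier M"
      then obtain c v where *: "c \<in> carrier R" "v \<in> W" "x = c \<odot>\<^bsub>M\<^esub> a \<oplus>\<^bsub>M\<^esub> v"
        using decomp by metis
      have v: "v \<in> carrier M" using * WE(1) by auto
      have "d \<odot>\<^bsub>M\<^esub> x = (d \<otimes>\<^bsub>R\<^esub> c) \<odot>\<^bsub>M\<^esub> a \<oplus>\<^bsub>M\<^esub> (d \<odot>\<^bsub>M\<^esub> v)"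
        using * v a d by (simp add: smult_r_distr smult_assoc1)
      then have "f (d \<odot>\<^bsub>M\<^esub> x) = d \<otimes>\<^bsub>R\<^esub> c" using * d WE(4) by (simp add: f_eq)
      then show "f (d \<odot>\<^bsub>M\<^esub> x) = d \<odot>\<^bsub>self_algebra R\<^esub> f x" using * by (simp add: f_eq)
    qed
    show "f a = \<one>\<^bsub>R\<^esub>"
      using f_eq[of "\<one>\<^bsub>R\<^esub>" "\<zero>\<^bsub>M\<^esub>"] a submodule_zero_closed[OF W(1)] by simp
    show "f v = \<zero>\<^bsub>R\<^esub>" if "v \<in> V" for v
    proof -
      have "v \<in> W" using that W(2) by blast
      moreover from this have "v \<in> carrier M" using WE(1) by blast
      ultimately show ?thesis using f_eq[of "\<zero>\<^bsub>R\<^esub>" v] a by simp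
    qed
  qed
qed

end

text \<open>
  Over a field this is linear independence of the list; in this form it is ready for contractions.
\<close>

definition has_dual_functionals ::
  "('r, 'x) ring_scheme \<Rightarrow> ('r, 'm, 'y) module_scheme \<Rightarrow> 'm list \<Rightarrow> bool"
  where "has_dual_functionals R M xs \<longleftrightarrow> (\<forall>ys x zs. xs = ys @ x # zs \<longrightarrow>
    (\<exists>f\<in>linear_maps R M (self_algebra R). f x = \<one>\<^bsub>R\<^esub> \<and> (\<forall>y\<in>set (ys @ zs). f y = \<zero>\<^bsub>R\<^esub>)))"

lemma dual_functionalE:
  assumes "has_dual_functionals R M (ys @ x # zs)"
  obtains f where "f \<in> linear_maps R M (self_algebra R)" and "f x = \<one>\<^bsub>R\<^esub>"
    and "\<forall>y\<in>set (ys @ zs). f y = \<zero>\<^bsub>R\<^esub>"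
  using assms unfolding has_dual_functionals_def by blast

context module_pair
begin

text \<open>
  If \<open>m = \<Sum> c\<^sub>i m\<^sub>i\<close> then \<open>m \<otimes> n + \<Sum> m\<^sub>i \<otimes> n\<^sub>i = \<Sum> m\<^sub>i \<otimes> (n\<^sub>i + c\<^sub>i n)\<close>: a linearly dependent summand
  can be absorbed into the others.
\<close>

lemma shorten_tensor:
  assumes X: "submodule X R N" and V: "V \<subseteq> carrier M" and n: "n \<in> X"
    and "set ys \<subseteq> V \<times> X" and "m \<in> lin_span R M (map fst ys)"
  shows "\<exists>zs. length zs = length ys \<and> set zs \<subseteq> V \<times> X \<and>
    tensor_class R M N ((m, n) # ys) = tensor_class R M N zs"
  using assms(4,5)
proof (induction ys arbitrary: m)
  case Nil
  then show ?case
    using n M.zero_closed submodule.axioms(1) N.submoduleE(1)[OF X]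
      tensor_class_eqI[OF tensor_eq_zero_left[of n]] by auto
next
  case (Cons y ys)
  interpret T: module R "tensor R M N" by (rule tensor_module)
  obtain m1 n1 where y: "y = (m1, n1)" by (cases y)
  obtain c s where cs: "c \<in> carrier R" "m = c \<odot>\<^bsub>M\<^esub> m1 \<oplus>\<^bsub>M\<^esub> s" "s \<in> lin_span R M (map fst ys)"
    using Cons.prems(2) y by auto
  obtain zs where zs: "length zs = length ys" "set zs \<subseteq> V \<times> X"
    "tensor_class R M N ((s, n) # ys) = tensor_class R M N zs"
    using Cons.IH[OF _ cs(3)] Cons.prems(1) by auto
  note XE = N.submoduleE[OF X]
  have VX: "V \<times> X \<subseteq> carrier M \<times> carrier N" using V XE(1) by auto
  have mem: "m1 \<in> carrier M" "n1 \<in> carrier N" "n \<in> carrier N" "m1 \<in> V" "n1 \<in> X"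
    using Cons.prems(1) y V XE(1) n by auto
  have sets: "set ys \<subseteq> carrier M \<times> carrier N" "set zs \<subseteq> carrier M \<times> carrier N"
    using Cons.prems(1) zs VX by auto
  have "set (map fst ys) \<subseteq> carrier M" using sets by auto
  then have s: "s \<in> carrier M"
    using cs(3) M.submoduleE(1)[OF M.lin_span_submodule] by blast
  have m: "m \<in> carrier M" using cs s mem by simp
  let ?p = "pure_tensor R M N"
  have "tensor_class R M N ((m, n) # y # ys) =
      (c \<odot>\<^bsub>tensor R M N\<^esub> ?p m1 n \<oplus>\<^bsub>tensor R M N\<^esub> ?p s n) \<oplus>\<^bsub>tensor R M N\<^esub>
        (?p m1 n1 \<oplus>\<^bsub>tensor R M N\<^esub> tensor_class R M N ys)"
    using m mem sets cs s y
    by (simp add: tensor_class_Cons pure_tensor_add_left pure_tensor_smult_left)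
  also have "\<dots> = (c \<odot>\<^bsub>tensor R M N\<^esub> ?p m1 n \<oplus>\<^bsub>tensor R M N\<^esub> ?p m1 n1) \<oplus>\<^bsub>tensor R M N\<^esub>
        (?p s n \<oplus>\<^bsub>tensor R M N\<^esub> tensor_class R M N ys)"
    using m mem sets cs s by (simp add: T.a_ac pure_tensor_closed tensor_class_closed)
  also have "?p s n \<oplus>\<^bsub>tensor R M N\<^esub> tensor_class R M N ys = tensor_class R M N zs"
    using zs(3) s mem sets by (simp add: tensor_class_Cons)
  also have "c \<odot>\<^bsub>tensor R M N\<^esub> ?p m1 n \<oplus>\<^bsub>tensor R M N\<^esub> ?p m1 n1 = ?p m1 (c \<odot>\<^bsub>N\<^esub> n \<oplus>\<^bsub>N\<^esub> n1)"
    using mem cs by (simp add: pure_tensor_add_right pure_tensor_smult_right)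
  finally have "tensor_class R M N ((m, n) # y # ys) =
      tensor_class R M N ((m1, c \<odot>\<^bsub>N\<^esub> n \<oplus>\<^bsub>N\<^esub> n1) # zs)"
    using mem cs sets by (simp add: tensor_class_Cons)
  moreover have "c \<odot>\<^bsub>N\<^esub> n \<oplus>\<^bsub>N\<^esub> n1 \<in> X" using XE(4,5) n mem cs by blast
  ultimately show ?case
    using zs mem by (intro exI[of _ "(m1, c \<odot>\<^bsub>N\<^esub> n \<oplus>\<^bsub>N\<^esub> n1) # zs"]) auto
qed

text \<open>
  A representation of minimal length has independent first components, since a dependence would allow
  one to shorten it.
\<close>

lemma independent_left_representation:
  assumes "field R" and X: "submodule X R N" and V: "V \<subseteq> carrier M"
    and z: "z \<in> tensor_image R M N V X"
  obtains xs where "set xs \<subseteq> V \<times> X" and "z = tensor_class R M N xs"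
    and "has_dual_functionals R M (map fst xs)"
proof -
  let ?P = "\<lambda>xs. set xs \<subseteq> V \<times> X \<and> z = tensor_class R M N xs"
  have "\<exists>xs. ?P xs" using z by (auto simp: tensor_image_def)
  then obtain xs where xs: "?P xs" and min: "\<And>ys. ?P ys \<Longrightarrow> length xs \<le> length ys"
    using ex_has_least_nat[of ?P _ length] by metis
  have VX: "V \<times> X \<subseteq> carrier M \<times> carrier N" using V N.submoduleE(1)[OF X] by auto
  have "has_dual_functionals R M (map fst xs)"
    unfolding has_dual_functionals_def
  proof (intro allI impI)
    fix as m bs assume "map fst xs = as @ m # bs"
    then obtain ys zs n where split: "xs = ys @ (m, n) # zs" "as = map fst ys" "bs = map fst zs"
      by (auto simp: map_eq_append_conv map_eq_Cons_conv)
    have sub: "set ys \<subseteq> V \<times> X" "set zs \<subseteq> V \<times> X" "m \<in> V" "n \<in> X" using xs split by auto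
    have "m \<notin> lin_span R M (map fst (ys @ zs))"
    proof
      assume "m \<in> lin_span R M (map fst (ys @ zs))"
      then obtain ws where ws: "length ws = length (ys @ zs)" "set ws \<subseteq> V \<times> X"
        "tensor_class R M N ((m, n) # ys @ zs) = tensor_class R M N ws"
        using shorten_tensor[OF X V, of n "ys @ zs" m] sub by auto
      have "tensor_class R M N xs = tensor_class R M N ((m, n) # ys @ zs)"
        using xs split VX by (intro tensor_class_eqI tensor_eq_mset) auto
      then have "?P ws" using ws xs by simp
      then show False using min[of ws] ws split by simp
    qed
    moreover have "set (map fst (ys @ zs)) \<subseteq> carrier M" using sub V by auto
    moreover have "m \<in> carrier M" using sub V by auto
    ultimately obtain f where "f \<in> linear_maps R M (self_algebra R)" "f m = \<one>\<^bsub>R\<^esub>"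
        "\<And>v. v \<in> lin_span R M (map fst (ys @ zs)) \<Longrightarrow> f v = \<zero>\<^bsub>R\<^esub>"
      using M.separating_functional[OF assms(1) M.lin_span_submodule] by metis
    moreover have "set (as @ bs) \<subseteq> lin_span R M (map fst (ys @ zs))"
      using M.lin_span_superset[OF \<open>set (map fst (ys @ zs)) \<subseteq> carrier M\<close>] split by simp
    ultimately show "\<exists>f\<in>linear_maps R M (self_algebra R). f m = \<one>\<^bsub>R\<^esub> \<and> (\<forall>y\<in>set (as @ bs). f y = \<zero>\<^bsub>R\<^esub>)"
      by (intro bexI[of _ f]) auto
  qed
  then show thesis using that xs by blast
qed

lemma independent_right_representation:
  assumes "field R" and z: "z \<in> carrier (tensor R M N)"
  obtains xs where "set xs \<subseteq> carrier M \<times> carrier N" and "z = tensor_class R M N xs"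
    and "has_dual_functionals R N (map snd xs)"
proof -
  interpret NM: module_pair R N M ..
  obtain xs where xs: "set xs \<subseteq> carrier M \<times> carrier N" "z = tensor_class R M N xs"
    using z by (rule tensor_cases)
  have "set (map prod.swap xs) \<subseteq> carrier N \<times> carrier M" using xs(1) by auto
  then obtain ys where ys: "set ys \<subseteq> carrier N \<times> carrier M"
    "tensor_class R N M (map prod.swap xs) = tensor_class R N M ys"
    "has_dual_functionals R N (map fst ys)"
    using NM.independent_left_representation[OF assms(1) M.carrier_is_submodule subset_refl,
        of "tensor_class R N M (map prod.swap xs)"]
    unfolding tensor_image_def by blast
  have "tensor_eq R N M (map prod.swap xs) ys"
    by (rule iffD1[OF NM.tensor_class_eq_iff[OF \<open>set (map prod.swap xs) \<subseteq> _\<close>] ys(2)])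
  from NM.tensor_eq_swap[OF this] have "tensor_eq R M N xs (map prod.swap ys)"
    by (simp add: comp_def)
  then have "z = tensor_class R M N (map prod.swap ys)" using xs(2) tensor_class_eqI by simp
  moreover have "set (map prod.swap ys) \<subseteq> carrier M \<times> carrier N" using ys(1) by auto
  moreover have "map snd (map prod.swap ys) = map fst ys" by simp
  ultimately show thesis using that ys(3) by metis
qed

lemma slice_left_dual:
  assumes f: "f \<in> linear_maps R M (self_algebra R)"
    and sub: "set (ys @ (m, n) # zs) \<subseteq> carrier M \<times> carrier N"
    and dual: "f m = \<one>\<^bsub>R\<^esub>" "\<forall>x\<in>set (map fst ys @ map fst zs). f x = \<zero>\<^bsub>R\<^esub>"
  shows "slice_left f (tensor_class R M N (ys @ (m, n) # zs)) = n"
proof -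
  interpret S: bilinear_map R M N N "\<lambda>m n. f m \<odot>\<^bsub>N\<^esub> n" by (rule slice_left_bilinear[OF f])
  have "S.eval_sum xs = \<zero>\<^bsub>N\<^esub>"
    if "set xs \<subseteq> carrier M \<times> carrier N" "\<forall>x\<in>fst ` set xs. f x = \<zero>\<^bsub>R\<^esub>" for xs
    using that by (induction xs) auto
  then have "S.eval_sum ys = \<zero>\<^bsub>N\<^esub>" "S.eval_sum zs = \<zero>\<^bsub>N\<^esub>" using sub dual by auto
  then show ?thesis using sub dual(1) by (simp add: S.lift_class S.eval_sum_append del: foldr_append)
qed

lemma slice_right_dual:
  assumes f: "f \<in> linear_maps R N (self_algebra R)"
    and sub: "set (ys @ (m, n) # zs) \<subseteq> carrier M \<times> carrier N"
    and dual: "f n = \<one>\<^bsub>R\<^esub>" "\<forall>x\<in>set (map snd ys @ map snd zs). f x = \<zero>\<^bsub>R\<^esub>"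
  shows "slice_right f (tensor_class R M N (ys @ (m, n) # zs)) = m"
proof -
  interpret S: bilinear_map R M N M "\<lambda>m n. f n \<odot>\<^bsub>M\<^esub> m" by (rule slice_right_bilinear[OF f])
  have "S.eval_sum xs = \<zero>\<^bsub>M\<^esub>"
    if "set xs \<subseteq> carrier M \<times> carrier N" "\<forall>x\<in>snd ` set xs. f x = \<zero>\<^bsub>R\<^esub>" for xs
    using that by (induction xs) auto
  then have "S.eval_sum ys = \<zero>\<^bsub>M\<^esub>" "S.eval_sum zs = \<zero>\<^bsub>M\<^esub>" using sub dual by auto
  then show ?thesis using sub dual(1) by (simp add: S.lift_class S.eval_sum_append del: foldr_append)
qed

lemma slice_left_in_submodule:
  assumes f: "f \<in> linear_maps R M (self_algebra R)" and X: "submodule X R N"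
    and xs: "set xs \<subseteq> carrier M \<times> X"
  shows "slice_left f (tensor_class R M N xs) \<in> X"
proof -
  interpret S: bilinear_map R M N N "\<lambda>m n. f m \<odot>\<^bsub>N\<^esub> n" by (rule slice_left_bilinear[OF f])
  note XE = N.submoduleE[OF X]
  have "S.eval_sum xs \<in> X"
    using xs N.submodule_zero_closed[OF X] linear_mapsD(1)[OF f]
    by (induction xs) (auto intro!: XE(4,5))
  moreover have "set xs \<subseteq> carrier M \<times> carrier N" using xs XE(1) by auto
  ultimately show ?thesis by (simp add: S.lift_class)
qed

lemma slice_right_in_submodule:
  assumes f: "f \<in> linear_maps R N (self_algebra R)" and V: "submodule V R M"
    and xs: "set xs \<subseteq> V \<times> carrier N"
  shows "slice_right f (tensor_class R M N xs) \<in> V"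
proof -
  interpret S: bilinear_map R M N M "\<lambda>m n. f n \<odot>\<^bsub>M\<^esub> m" by (rule slice_right_bilinear[OF f])
  note VE = M.submoduleE[OF V]
  have "S.eval_sum xs \<in> V"
    using xs M.submodule_zero_closed[OF V] linear_mapsD(1)[OF f]
    by (induction xs) (auto intro!: VE(4,5))
  moreover have "set xs \<subseteq> carrier M \<times> carrier N" using xs VE(1) by auto
  ultimately show ?thesis by (simp add: S.lift_class)
qed

text \<open>
  In a representation \<open>z = \<Sum> v\<^sub>i \<otimes> n\<^sub>i\<close> with independent \<open>v\<^sub>i\<close>,
  contraction by the functional dual to \<open>v\<^sub>i\<close> gives \<open>n\<^sub>i\<close>; a representation of \<open>z\<close> with second
  components in \<open>X\<close> shows that this contraction lies in \<open>X\<close>.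
\<close>

lemma tensor_image_Int:
  assumes "field R" and V: "V \<subseteq> carrier M" and X: "submodule X R N"
    and zV: "z \<in> tensor_image R M N V (carrier N)" and zX: "z \<in> tensor_image R M N (carrier M) X"
  shows "z \<in> tensor_image R M N V X"
proof -
  obtain xs where xs: "set xs \<subseteq> V \<times> carrier N" "z = tensor_class R M N xs"
    and dual: "has_dual_functionals R M (map fst xs)"
    using independent_left_representation[OF assms(1) N.carrier_is_submodule V zV] .
  obtain ys where ys: "set ys \<subseteq> carrier M \<times> X" "z = tensor_class R M N ys"
    using zX by (auto simp: tensor_image_def)
  have "n \<in> X" if mn: "(m, n) \<in> set xs" for m n
  proof -
    obtain as bs where split: "xs = as @ (m, n) # bs" using split_list[OF mn] by blast
    have "has_dual_functionals R M (map fst as @ m # map fst bs)" using dual split by simp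
    then obtain f where f: "f \<in> linear_maps R M (self_algebra R)" "f m = \<one>\<^bsub>R\<^esub>"
        "\<forall>x\<in>set (map fst as @ map fst bs). f x = \<zero>\<^bsub>R\<^esub>"
      by (rule dual_functionalE)
    have "set (as @ (m, n) # bs) \<subseteq> carrier M \<times> carrier N" using xs(1) V split by auto
    then have "slice_left f z = n"
      unfolding xs(2) split by (rule slice_left_dual[OF f(1) _ f(2,3)])
    then show ?thesis using slice_left_in_submodule[OF f(1) X ys(1)] ys(2) by simp
  qed
  then have "set xs \<subseteq> V \<times> X" using xs(1) by auto
  then show ?thesis using xs(2) by (auto simp: tensor_image_def)
qed

lemma tensor_image_mono:
  "V \<subseteq> V' \<Longrightarrow> X \<subseteq> X' \<Longrightarrow> tensor_image R M N V X \<subseteq> tensor_image R M N V' X'"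
  unfolding tensor_image_def by (intro image_mono) auto

lemma tensor_image_zero: "\<zero>\<^bsub>tensor R M N\<^esub> \<in> tensor_image R M N V X"
  unfolding tensor_image_def zero_tensor by (intro imageI) simp

lemma tensor_image_add:
  assumes "V \<subseteq> carrier M" and "X \<subseteq> carrier N"
    and "z \<in> tensor_image R M N V X" and "z' \<in> tensor_image R M N V X"
  shows "z \<oplus>\<^bsub>tensor R M N\<^esub> z' \<in> tensor_image R M N V X"
proof -
  obtain xs ys where *: "set xs \<subseteq> V \<times> X" "z = tensor_class R M N xs"
    "set ys \<subseteq> V \<times> X" "z' = tensor_class R M N ys"
    using assms(3,4) by (auto simp: tensor_image_def)
  have "V \<times> X \<subseteq> carrier M \<times> carrier N" using assms(1,2) by auto
  then have "z \<oplus>\<^bsub>tensor R M N\<^esub> z' = tensor_class R M N (xs @ ys)"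
    using * by (simp add: tensor_add_class)
  moreover have "set (xs @ ys) \<subseteq> V \<times> X" using * by simp
  ultimately show ?thesis unfolding tensor_image_def by blast
qed

lemma tensor_image_smult:
  assumes V: "submodule V R M" and "X \<subseteq> carrier N"
    and "z \<in> tensor_image R M N V X" and c: "c \<in> carrier R"
  shows "c \<odot>\<^bsub>tensor R M N\<^esub> z \<in> tensor_image R M N V X"
proof -
  obtain xs where *: "set xs \<subseteq> V \<times> X" "z = tensor_class R M N xs"
    using assms(3) by (auto simp: tensor_image_def)
  have "V \<times> X \<subseteq> carrier M \<times> carrier N" using M.submoduleE(1)[OF V] assms(2) by auto
  then have "c \<odot>\<^bsub>tensor R M N\<^esub> z = tensor_class R M N (map (\<lambda>(m, n). (c \<odot>\<^bsub>M\<^esub> m, n)) xs)"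
    using * c by (simp add: tensor_smult_class)
  moreover have "set (map (\<lambda>(m, n). (c \<odot>\<^bsub>M\<^esub> m, n)) xs) \<subseteq> V \<times> X"
    using * c M.submoduleE(4)[OF V] by auto
  ultimately show ?thesis unfolding tensor_image_def by blast
qed

end

section \<open>Submodules of a group module\<close>

locale group_scheme_module = G: affine_group_scheme k G + group_module k G M \<rho>
  for k :: "('k, 'x) ring_scheme" and G :: "('k, 'a) hopf_algebra"
    and M :: "('k, 'm) module" and \<rho> :: "'m \<Rightarrow> ('m \<times> 'a) list set"
begin

sublocale M: module k M by (rule vector_space)
sublocale MG: module_pair k M G ..
sublocale GG: module_pair k G G ..
sublocale MG_G: module_pair k "tensor k M G" G
  by (intro module_pair.intro MG.tensor_module G.module)

lemma field: "field k" ..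

lemma comult_linear: "comult G \<in> linear_maps k G (tensor k G G)"
  using G.comult_hom by (simp add: algebra_homs_def)

lemma counit_linear: "counit G \<in> linear_maps k G (self_algebra k)"
  using G.counit_hom by (simp add: algebra_homs_def)

lemma coaction_preimage_submodule:
  assumes V: "submodule V k M" and X: "X \<subseteq> carrier G"
  shows "submodule {m \<in> V. \<rho> m \<in> tensor_image k M G V X} k M"
proof (rule M.submoduleI_smult)
  note VE = M.submoduleE[OF V]
  note \<rho> = linear_mapsD[OF coaction_linear]
  show "{m \<in> V. \<rho> m \<in> tensor_image k M G V X} \<subseteq> carrier M" using VE(1) by auto
  show "\<zero>\<^bsub>M\<^esub> \<in> {m \<in> V. \<rho> m \<in> tensor_image k M G V X}"
    using linear_maps_zero[OF vector_space MG.tensor_module coaction_linear]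
      M.submodule_zero_closed[OF V] by (simp add: MG.tensor_image_zero)
  show "a \<oplus>\<^bsub>M\<^esub> b \<in> {m \<in> V. \<rho> m \<in> tensor_image k M G V X}"
    if "a \<in> {m \<in> V. \<rho> m \<in> tensor_image k M G V X}" "b \<in> {m \<in> V. \<rho> m \<in> tensor_image k M G V X}"
    for a b
  proof -
    have "\<rho> (a \<oplus>\<^bsub>M\<^esub> b) = \<rho> a \<oplus>\<^bsub>tensor k M G\<^esub> \<rho> b" using that VE(1) by (intro \<rho>) auto
    then show ?thesis using that VE(5) MG.tensor_image_add[OF VE(1) X] by simp
  qed
  show "c \<odot>\<^bsub>M\<^esub> a \<in> {m \<in> V. \<rho> m \<in> tensor_image k M G V X}"
    if "c \<in> carrier k" "a \<in> {m \<in> V. \<rho> m \<in> tensor_image k M G V X}" for c a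
  proof -
    have "\<rho> (c \<odot>\<^bsub>M\<^esub> a) = c \<odot>\<^bsub>tensor k M G\<^esub> \<rho> a" using that VE(1) by (intro \<rho>) auto
    then show ?thesis using that VE(4) MG.tensor_image_smult[OF V X] by simp
  qed
qed

lemma comodule_for_iff:
  assumes "X \<subseteq> carrier G"
  shows "comodule_for k G M \<rho> X V \<longleftrightarrow>
    submodule V k M \<and> (\<forall>m\<in>V. \<rho> m \<in> tensor_image k M G V X)"
  using MG.tensor_image_mono[OF subset_refl assms, of V]
  unfolding comodule_for_def group_submodule_def by blast

text \<open>
  The coaction condition is linear, so it suffices to check it on generators.
\<close>

lemma comodule_for_lin_span:
  assumes X: "X \<subseteq> carrier G" and ms: "set ms \<subseteq> carrier M"
    and coaction: "\<And>m. m \<in> set ms \<Longrightarrow> \<rho> m \<in> tensor_image k M G (lin_span k M ms) X"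
  shows "comodule_for k G M \<rho> X (lin_span k M ms)"
proof -
  let ?V = "lin_span k M ms"
  have V: "submodule ?V k M" using ms by (rule M.lin_span_submodule)
  have "?V \<subseteq> {m \<in> ?V. \<rho> m \<in> tensor_image k M G ?V X}"
    using coaction M.lin_span_superset[OF ms]
    by (intro M.lin_span_least coaction_preimage_submodule V X) auto
  then show ?thesis unfolding comodule_for_iff[OF X] using V by blast
qed

text \<open>
  Write \<open>\<rho>(m) = \<Sum> m\<^sub>i \<otimes> a\<^sub>i\<close> with independent \<open>a\<^sub>i\<close>, and let \<open>f\<^sub>i\<close> be the
  dual functionals.  Coassociativity says \<open>\<Sum> \<rho>(m\<^sub>j) \<otimes> a\<^sub>j = \<Sum> m\<^sub>j \<otimes> \<Delta>(a\<^sub>j)\<close>, and contraction of the last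
  factor by \<open>f\<^sub>i\<close> yields \<open>\<rho>(m\<^sub>i) = \<Sum> m\<^sub>j \<otimes> (id \<otimes> f\<^sub>i)(\<Delta>(a\<^sub>j))\<close>.  Hence the span of the \<open>m\<^sub>i\<close> is stable
  under the coaction, and it contains \<open>m = \<Sum> \<epsilon>(a\<^sub>i) m\<^sub>i\<close>.
\<close>

lemma local_finiteness:
  assumes m: "m \<in> carrier M"
  obtains ms where "set ms \<subseteq> carrier M" and "m \<in> lin_span k M ms"
    and "\<forall>n\<in>set ms. \<rho> n \<in> tensor_image k M G (lin_span k M ms) (carrier G)"
proof -
  have "\<rho> m \<in> carrier (tensor k M G)" using linear_mapsD(1)[OF coaction_linear m] .
  then obtain xs where xs: "set xs \<subseteq> carrier M \<times> carrier G" "\<rho> m = tensor_class k M G xs"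
    and dual: "has_dual_functionals k G (map snd xs)"
    using MG.independent_right_representation[OF field] by metis
  define V where "V = lin_span k M (map fst xs)"
  have fst_xs: "set (map fst xs) \<subseteq> carrier M" using xs(1) by auto
  have V: "submodule V k M" unfolding V_def using fst_xs by (rule M.lin_span_submodule)
  have "set (map fst xs) \<subseteq> V" unfolding V_def using fst_xs by (rule M.lin_span_superset)
  then have xs_V: "set xs \<subseteq> V \<times> carrier G" using xs(1) by auto
  have m_V: "m \<in> V"
    using MG.slice_right_in_submodule[OF counit_linear V xs_V] coaction_counit[OF m] xs(2) by simp
  have "\<rho> n \<in> tensor_image k M G V (carrier G)" if n: "n \<in> set (map fst xs)" for n
  proof -
    obtain a where "(n, a) \<in> set xs" using n by auto
    then obtain ys zs where split: "xs = ys @ (n, a) # zs" by (meson split_list)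
    have "has_dual_functionals k G (map snd ys @ a # map snd zs)" using dual split by simp
    then obtain f where f: "f \<in> linear_maps k G (self_algebra k)" "f a = \<one>\<^bsub>k\<^esub>"
        "\<forall>b\<in>set (map snd ys @ map snd zs). f b = \<zero>\<^bsub>k\<^esub>"
      by (rule dual_functionalE)
    note slice = bilinear_map.lift_linear[OF GG.slice_right_bilinear[OF f(1)]]
    \<comment> \<open>The left side of coassociativity, before reassociation.\<close>
    define L where "L = tensor_map k (tensor k M G) G \<rho> (\<lambda>a. a) (\<rho> m)"
    have L: "L = tensor_class k (tensor k M G) G (map (\<lambda>(x, b). (\<rho> x, b)) xs)"
      unfolding L_def xs(2)
      by (rule tensor_map_class[OF MG.tensor_module G.module vector_space G.module
            coaction_linear linear_maps_id xs(1)])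
    have L_sub: "set (map (\<lambda>(x, b). (\<rho> x, b)) xs) \<subseteq> carrier (tensor k M G) \<times> carrier G"
      using xs(1) linear_mapsD(1)[OF coaction_linear] by auto
    have "\<rho> n = MG_G.slice_right f L"
    proof -
      have snd_map: "map snd (map (\<lambda>(x, b). (\<rho> x, b)) ws) = map snd ws" for ws
        by (induction ws) auto
      have map_split: "map (\<lambda>(x, b). (\<rho> x, b)) xs =
          map (\<lambda>(x, b). (\<rho> x, b)) ys @ (\<rho> n, a) # map (\<lambda>(x, b). (\<rho> x, b)) zs"
        using split by simp
      show ?thesis
        unfolding L map_split
      proof (rule MG_G.slice_right_dual[OF f(1) _ f(2), symmetric])
        show "set (map (\<lambda>(x, b). (\<rho> x, b)) ys @ (\<rho> n, a) # map (\<lambda>(x, b). (\<rho> x, b)) zs)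
            \<subseteq> carrier (tensor k M G) \<times> carrier G"
          using L_sub unfolding map_split .
        show "\<forall>b\<in>set (map snd (map (\<lambda>(x, b). (\<rho> x, b)) ys) @
            map snd (map (\<lambda>(x, b). (\<rho> x, b)) zs)). f b = \<zero>\<^bsub>k\<^esub>"
          unfolding snd_map by (rule f(3))
      qed
    qed
    also have "\<dots> = tensor_map k M G (\<lambda>x. x) (GG.slice_right f) (tensor_assoc k M G G L)"
      using slice_right_assoc[OF vector_space G.module G.module f(1)] MG_G.tensor_class_closed[OF L_sub]
      by (simp add: L)
    also have "tensor_assoc k M G G L = tensor_map k M (tensor k G G) (\<lambda>x. x) (comult G) (\<rho> m)"
      unfolding L_def by (rule coaction_coassociative[OF m])
    also have "\<dots> = tensor_class k M (tensor k G G) (map (\<lambda>(x, b). (x, comult G b)) xs)"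
      unfolding xs(2)
      by (rule tensor_map_class[OF vector_space GG.tensor_module vector_space G.module
            linear_maps_id comult_linear xs(1)])
    also have "tensor_map k M G (\<lambda>x. x) (GG.slice_right f) \<dots> =
        tensor_class k M G (map (\<lambda>(x, b). (x, GG.slice_right f b)) (map (\<lambda>(x, b). (x, comult G b)) xs))"
      using xs(1) linear_mapsD(1)[OF comult_linear]
      by (intro tensor_map_class[OF vector_space G.module vector_space GG.tensor_module
            linear_maps_id slice]) auto
    also have "\<dots> \<in> tensor_image k M G V (carrier G)"
      unfolding tensor_image_def
      using xs_V linear_mapsD(1)[OF comult_linear] linear_mapsD(1)[OF slice]
      by (intro imageI) auto
    finally show ?thesis .
  qed
  then show thesis using that[OF fst_xs] m_V unfolding V_def by blast
qed

lemma comodule_part_subset: "X \<subseteq> carrier G \<Longrightarrow> comodule_part k G M \<rho> X \<subseteq> carrier M"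
  unfolding comodule_part_def using comodule_for_iff M.submoduleE(1) by blast

lemma comodule_for_zero:
  assumes "X \<subseteq> carrier G"
  shows "comodule_for k G M \<rho> X {\<zero>\<^bsub>M\<^esub>}"
  using comodule_for_lin_span[OF assms, of "[]"] by simp

text \<open>
  The \<open>X\<close>-comodules in \<open>M\<close> are directed, so that their union is a submodule.
\<close>

lemma comodule_for_sum:
  assumes X: "X \<subseteq> carrier G" and V: "comodule_for k G M \<rho> X V" and W: "comodule_for k G M \<rho> X W"
  shows "comodule_for k G M \<rho> X {v \<oplus>\<^bsub>M\<^esub> w | v w. v \<in> V \<and> w \<in> W}" (is "comodule_for k G M \<rho> X ?S")
proof -
  have sub: "submodule V k M" "submodule W k M" using V W comodule_for_iff[OF X] by auto
  note S = M.submodule_sum[OF sub]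
  let ?S' = "{m \<in> ?S. \<rho> m \<in> tensor_image k M G ?S X}"
  note S' = M.submoduleE(5)[OF coaction_preimage_submodule[OF S(1) X]]
  have "V \<subseteq> ?S'" "W \<subseteq> ?S'"
    using V W S(2,3) comodule_for_iff[OF X] MG.tensor_image_mono[OF S(2) subset_refl, of X]
      MG.tensor_image_mono[OF S(3) subset_refl, of X] by blast+
  then have "?S \<subseteq> ?S'" using S' by blast
  then show ?thesis unfolding comodule_for_iff[OF X] using S(1) by blast
qed

lemma comodule_part_group_submodule:
  assumes X: "X \<subseteq> carrier G"
  shows "group_submodule k G M \<rho> (comodule_part k G M \<rho> X)"
proof -
  let ?P = "comodule_part k G M \<rho> X"
  have mem: "m \<in> ?P \<longleftrightarrow> (\<exists>V. comodule_for k G M \<rho> X V \<and> m \<in> V)" for m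
    by (auto simp: comodule_part_def)
  have "submodule ?P k M"
  proof (rule M.submoduleI_smult)
    show "?P \<subseteq> carrier M" by (rule comodule_part_subset[OF X])
    show "\<zero>\<^bsub>M\<^esub> \<in> ?P" using comodule_for_zero[OF X] mem by blast
    show "a \<oplus>\<^bsub>M\<^esub> b \<in> ?P" if "a \<in> ?P" "b \<in> ?P" for a b
      using that comodule_for_sum[OF X] unfolding mem by blast
    show "c \<odot>\<^bsub>M\<^esub> a \<in> ?P" if "c \<in> carrier k" "a \<in> ?P" for c a
      using that comodule_for_iff[OF X] M.submoduleE(4) unfolding mem by metis
  qed
  moreover have "\<rho> m \<in> tensor_image k M G ?P (carrier G)" if "m \<in> ?P" for m
  proof -
    obtain V where V: "comodule_for k G M \<rho> X V" "m \<in> V" using \<open>m \<in> ?P\<close> mem by blast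
    then have "V \<subseteq> ?P" using mem by blast
    then show ?thesis
      using V comodule_for_iff[OF X] MG.tensor_image_mono[OF _ X] by blast
  qed
  ultimately show ?thesis unfolding group_submodule_def by blast
qed

lemma comodule_part_mono:
  assumes "X \<subseteq> Y" and Y: "Y \<subseteq> carrier G"
  shows "comodule_part k G M \<rho> X \<subseteq> comodule_part k G M \<rho> Y"
proof -
  have "comodule_for k G M \<rho> Y V" if "comodule_for k G M \<rho> X V" for V
    using that MG.tensor_image_mono[OF subset_refl assms(1), of V]
    unfolding comodule_for_def by blast
  then show ?thesis unfolding comodule_part_def by blast
qed

lemma comodule_part_coaction:
  assumes X: "X \<subseteq> carrier G" and m: "m \<in> comodule_part k G M \<rho> X"
  shows "\<rho> m \<in> tensor_image k M G (carrier M) X"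
proof -
  obtain V where V: "comodule_for k G M \<rho> X V" "m \<in> V"
    using m by (auto simp: comodule_part_def)
  then have "V \<subseteq> carrier M" using comodule_for_iff[OF X] M.submoduleE(1) by blast
  then show ?thesis
    using V comodule_for_iff[OF X] MG.tensor_image_mono[OF _ subset_refl] by blast
qed

text \<open>
  A submodule has \<open>\<rho>(N) \<subseteq> N \<otimes> k[G]\<close>; if also \<open>\<rho>(N) \<subseteq> M \<otimes> X\<close>, then \<open>\<rho>(N) \<subseteq> N \<otimes> X\<close> by intersecting
  the two.
\<close>

lemma group_submodule_comodule_for:
  assumes X: "submodule X k G" and N: "group_submodule k G M \<rho> N"
    and coaction: "\<And>m. m \<in> N \<Longrightarrow> \<rho> m \<in> tensor_image k M G (carrier M) X"
  shows "comodule_for k G M \<rho> X N"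
proof -
  have sub: "submodule N k M" and N': "\<And>m. m \<in> N \<Longrightarrow> \<rho> m \<in> tensor_image k M G N (carrier G)"
    using N by (auto simp: group_submodule_def)
  have "X \<subseteq> carrier G" using G.submoduleE(1)[OF X] .
  then show ?thesis
    using sub MG.tensor_image_Int[OF field M.submoduleE(1)[OF sub] X N' coaction]
    by (simp add: comodule_for_iff)
qed

text \<open>
  Every element lies in a finitely generated submodule, whose coaction involves finitely many
  functions on the group; these all lie in one member of the exhausting filtration.
\<close>

lemma comodule_parts_exhaust:
  assumes sub: "\<And>d. X d \<subseteq> carrier G" and mono: "mono X" and exhaust: "(\<Union>d. X d) = carrier G"
  shows "(\<Union>d::nat. comodule_part k G M \<rho> (X d)) = carrier M"
proof
  show "(\<Union>d. comodule_part k G M \<rho> (X d)) \<subseteq> carrier M"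
    using comodule_part_subset sub by blast
  show "carrier M \<subseteq> (\<Union>d. comodule_part k G M \<rho> (X d))"
  proof
    fix m assume "m \<in> carrier M"
    then obtain ms where ms: "set ms \<subseteq> carrier M" "m \<in> lin_span k M ms"
      "\<forall>n\<in>set ms. \<rho> n \<in> tensor_image k M G (lin_span k M ms) (carrier G)"
      by (rule local_finiteness)
    let ?V = "lin_span k M ms"
    have finite_level: "\<exists>d. A \<subseteq> X d" if "finite A" "A \<subseteq> carrier G" for A
      using that
    proof (induction A)
      case (insert a A)
      then obtain d e where "A \<subseteq> X d" "a \<in> X e" using exhaust by blast
      moreover have "X d \<subseteq> X (max d e)" "X e \<subseteq> X (max d e)" using mono by (simp_all add: monoD)
      ultimately have "insert a A \<subseteq> X (max d e)" by blast
      then show ?case ..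
    qed simp
    have "\<exists>xs. set xs \<subseteq> ?V \<times> carrier G \<and> \<rho> n = tensor_class k M G xs" if "n \<in> set ms" for n
      using bspec[OF ms(3) that] by (auto simp: tensor_image_def)
    then obtain xs where xs: "\<And>n. n \<in> set ms \<Longrightarrow> set (xs n) \<subseteq> ?V \<times> carrier G"
      "\<And>n. n \<in> set ms \<Longrightarrow> \<rho> n = tensor_class k M G (xs n)"
      by metis
    have "(\<Union>n\<in>set ms. snd ` set (xs n)) \<subseteq> carrier G" using xs(1) by fastforce
    then obtain d where d: "(\<Union>n\<in>set ms. snd ` set (xs n)) \<subseteq> X d"
      using finite_level[of "\<Union>n\<in>set ms. snd ` set (xs n)"] by blast
    have "\<rho> n \<in> tensor_image k M G ?V (X d)" if n: "n \<in> set ms" for n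
    proof -
      have "snd ` set (xs n) \<subseteq> X d" using d n by blast
      then have "set (xs n) \<subseteq> ?V \<times> X d"
        using xs(1)[OF n] unfolding subset_iff mem_Times_iff by blast
      then show ?thesis using xs(2)[OF n] by (auto simp: tensor_image_def)
    qed
    then have "comodule_for k G M \<rho> (X d) ?V" using ms(1) sub by (intro comodule_for_lin_span)
    then show "m \<in> (\<Union>d. comodule_part k G M \<rho> (X d))"
      using ms(2) by (auto simp: comodule_part_def)
  qed
qed

end

section \<open>The filtration by exponential degree\<close>

text \<open>
  Coefficients depend linearly on the polynomial; in this form it is apparent that the polynomials of
  bounded degree are a subspace.
\<close>

lemma deg_le_iff:
  fixes P :: "('k, 'n) module"
  assumes P: "ring P" and f: "f \<in> carrier (UP P)"
  shows "deg P f \<le> d \<longleftrightarrow> (\<forall>n>d. f n = \<zero>\<^bsub>P\<^esub>)"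
proof -
  interpret UP_ring P "UP P" using P by (simp add: UP_ring_def)
  have "coeff (UP P) f n = f n" for n using f by (simp add: UP_def)
  then show ?thesis
    using deg_aboveI[of d f] deg_aboveD[of f] f by (metis order_le_less_trans)
qed

context
  fixes k :: "('k, 'x) ring_scheme" and G :: "('k, 'a) hopf_algebra"
    and P :: "('k, 'n) module" and E :: "'a \<Rightarrow> nat \<Rightarrow> 'n"
  assumes G: "module k G" and P: "algebra k P"
    and E: "E \<in> linear_maps k G (poly_algebra P)"
begin

lemma ring_P: "ring P"
  using algebra.M_cring[OF P] by (rule cring.axioms(1))

lemma exp_degree_functions_eq:
  "exp_degree_functions G P E d = {a \<in> carrier G. \<forall>n>d. E a n = \<zero>\<^bsub>P\<^esub>}"
proof -
  have "E a \<in> carrier (UP P)" if "a \<in> carrier G" for a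
    using linear_mapsD(1)[OF E that] by (simp add: poly_algebra_def)
  then show ?thesis
    using deg_le_iff[OF ring_P] by (auto simp: exp_degree_functions_def)
qed

lemma exp_degree_functions_mono: "mono (exp_degree_functions G P E)"
  by (rule monoI) (auto simp: exp_degree_functions_def)

lemma exp_degree_functions_exhaust: "(\<Union>d. exp_degree_functions G P E d) = carrier G"
  using linear_mapsD(1)[OF E] by (auto simp: exp_degree_functions_def poly_algebra_def)

lemma exp_degree_functions_submodule: "submodule (exp_degree_functions G P E d) k G"
proof -
  interpret G: module k G by (rule G)
  interpret P: algebra k P by (rule P)
  interpret UP_ring P "UP P" using ring_P by (simp add: UP_ring_def)
  have closed: "E a \<in> carrier (UP P)" if "a \<in> carrier G" for a
    using linear_mapsD(1)[OF E that] by (simp add: poly_algebra_def)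
  have smult: "E (c \<odot>\<^bsub>G\<^esub> a) n = c \<odot>\<^bsub>P\<^esub> E a n" if "c \<in> carrier k" "a \<in> carrier G" for c a n
    using linear_mapsD(3)[OF E that] by (simp add: poly_algebra_def)
  have add: "E (a \<oplus>\<^bsub>G\<^esub> b) n = E a n \<oplus>\<^bsub>P\<^esub> E b n" if "a \<in> carrier G" "b \<in> carrier G" for a b n
    using linear_mapsD(2)[OF E that] closed[OF that(1)] closed[OF that(2)]
    by (simp add: poly_algebra_def UP_def)
  have "E a n \<in> carrier P" if "a \<in> carrier G" for a n
    using closed[OF that] by (auto simp: UP_def)
  then have zero: "E \<zero>\<^bsub>G\<^esub> n = \<zero>\<^bsub>P\<^esub>" for n
    using smult[of "\<zero>\<^bsub>k\<^esub>" "\<zero>\<^bsub>G\<^esub>" n] by simp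
  show ?thesis
    unfolding exp_degree_functions_eq
    by (rule G.submoduleI_smult) (auto simp: zero add smult)
qed

end

theorem proposition2p8:
  fixes k :: "('k, 'x) ring_scheme"
    and G :: "('k, 'a) hopf_algebra"
    and P :: "('k, 'n) module"
    and u :: "'a \<Rightarrow> 'n"
    and E :: "'a \<Rightarrow> nat \<Rightarrow> 'n"
    and M :: "('k, 'm) module"
    and \<rho> :: "'m \<Rightarrow> ('m \<times> 'a) list set"
  assumes "field k" and "has_characteristic k p" and "p > 0"
    and "linear_algebraic_group TYPE('u) k G"
    and "exponential_type TYPE('u) k p G P u E"
    and "group_module k G M \<rho>"
  shows "submodule_filtration k G M \<rho>
      (\<lambda>d. comodule_part k G M \<rho> (exp_degree_functions G P E d)) \<and>
    (\<Union>d. comodule_part k G M \<rho> (exp_degree_functions G P E d)) = carrier M \<and>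
    (\<forall>d. comodule_part k G M \<rho> (exp_degree_functions G P E d) \<subseteq> exp_degree_part k G P E M \<rho> d) \<and>
    (\<forall>N. submodule_filtration k G M \<rho> N \<longrightarrow>
      (\<forall>d. N d \<subseteq> exp_degree_part k G P E M \<rho> d) \<longrightarrow>
      (\<forall>d. N d \<subseteq> comodule_part k G M \<rho> (exp_degree_functions G P E d)))"
proof -
  have "affine_group_scheme k G" using assms(4) by (simp add: linear_algebraic_group_def)
  then interpret group_scheme_module k G M \<rho>
    using assms(6) by (simp add: group_scheme_module_def)
  have P: "algebra k P"
    using exponential_type.cone[OF assms(5)] by (simp add: p_nilpotent_cone_def)
  have E: "E \<in> linear_maps k G (poly_algebra P)"
    using exponential_type.morphism[OF assms(5)] by (simp add: algebra_homs_def)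
  let ?X = "exp_degree_functions G P E"
  note X_submodule = exp_degree_functions_submodule[OF G.module P E]
  have X: "?X d \<subseteq> carrier G" for d by (auto simp: exp_degree_functions_def)
  note X_mono = exp_degree_functions_mono[OF G.module P E]
  note X_exhaust = exp_degree_functions_exhaust[OF G.module P E]
  have "submodule_filtration k G M \<rho> (\<lambda>d. comodule_part k G M \<rho> (?X d))"
    unfolding submodule_filtration_def
    by (intro conjI allI monoI comodule_part_group_submodule comodule_part_mono X monoD[OF X_mono])
  moreover have "(\<Union>d. comodule_part k G M \<rho> (?X d)) = carrier M"
    by (rule comodule_parts_exhaust[OF X X_mono X_exhaust])
  moreover have "comodule_part k G M \<rho> (?X d) \<subseteq> exp_degree_part k G P E M \<rho> d" for d
    using comodule_part_subset[OF X] comodule_part_coaction[OF X]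
    by (auto simp: exp_degree_part_def)
  moreover have "N d \<subseteq> comodule_part k G M \<rho> (?X d)"
    if N: "submodule_filtration k G M \<rho> N" and sub: "\<And>d. N d \<subseteq> exp_degree_part k G P E M \<rho> d" for N d
  proof -
    have "comodule_for k G M \<rho> (?X d) (N d)"
      using N sub[of d] X_submodule
      by (intro group_submodule_comodule_for) (auto simp: submodule_filtration_def exp_degree_part_def)
    then show ?thesis by (auto simp: comodule_part_def)
  qed
  ultimately show ?thesis by blast
qed

end
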